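(* Let $\lambda\in\mathbb R$ and let $\gamma(t)=\Psi(u(t),v(t))$, $t\in[a,b]$, be a smooth non-degenerate curve in $(\mathbb S_1^2)_{xy}^+=\{(x,y,z)\in\mathbb S_1^2:z>0\}$. Let $d_{xy}(t)$ be the distance of $\gamma(t)$ to the plane $\Pi_{xy}=\{z=0\}$, let $\mathbf n$ be the principal normal vector of $\gamma$, let $Z=\partial_z$, and assume $d_{xy}(t)+\lambda\neq0$ for all $t$. Then $\gamma$ is a catenary with respect to $\Pi_{xy}$ (with Lagrange multiplier $\lambda$) if and only if its curvature $\kappa$ satisfies $$\kappa(t)=\frac{\langle\mathbf n(t),Z\rangle}{d_{xy}(t)+\lambda}.$$
   Context: $\mathbb L^3$ is $\mathbb R^3$ with the metric $\langle\,,\rangle=(dx)^2+(dy)^2-(dz)^2$, and $\mathbb S_1^2=\{(x,y,z):x^2+y^2-z^2=1\}$ with the induced metric, parametrized by $\Psi\colon\mathbb R^2\to\mathbb S_1^2$, $\Psi(u,v)=(\cosh(u)\cos v,\cosh(u)\sin v,\sinh(u))$. A curve $\gamma$ is non-degenerate if it is spacelike ($\langle\gamma',\gamma'\rangle>0$ everywhere; $\epsilon=1$) or timelike ($\langle\gamma',\gamma'\rangle<0$ everywhere; $\epsilon=-1$). For $\gamma(t)=\Psi(u(t),v(t))$ one has $|\gamma'|=\sqrt{\epsilon\langle\gamma',\gamma'\rangle}=\sqrt{\epsilon(v'^2\cosh(u)^2-u'^2)}$. With $\xi(p)=-p$ and $\times$ the Lorentzian cross product, $\langle a\times b,c\rangle=\det(a,b,c)$,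 the (geodesic) curvature of $\gamma$ in $\mathbb S_1^2$ is $\kappa=\epsilon\,\dfrac{\langle\gamma'',\gamma'\times\xi(\gamma)\rangle}{|\gamma'|^3}=\epsilon\,\dfrac{\det(\gamma,\gamma',\gamma'')}{|\gamma'|^3}$, and the principal normal vector is $\mathbf n=\dfrac{\xi(\gamma)\times\gamma'}{|\gamma'|}=-\dfrac{\gamma\times\gamma'}{|\gamma'|}$. The distance of a point $(x,y,z)\in(\mathbb S_1^2)_{xy}^+$ to $\Pi_{xy}$ is $z$, so $d_{xy}(t)=\sinh u(t)$. A catenary with respect to $\Pi_{xy}$ with Lagrange multiplier $\lambda$ is a critical point, among curves in $(\mathbb S_1^2)_{xy}^+$ with the same endpoints, of $$\mathcal E_{xy}[\gamma]=\int_a^b(\sinh(u)+\lambda)\sqrt{\epsilon(v'^2\cosh(u)^2-u'^2)}\,dt,$$ i.e. a solution of its Euler-Lagrange equations. *)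

theory Defs
  imports "HOL-Analysis.Analysis"
begin

text \<open>Smoothness on a set on which derivatives are unique (an interval
  \<open>{a..b}\<close> or a strip \<open>{-\<delta><..<\<delta>} \<times> {a..b}\<close>); derivatives are taken within the set,
  so they are one-sided at boundary points.\<close>

primrec Ck_on :: "nat \<Rightarrow> 'a::real_normed_vector set \<Rightarrow> ('a \<Rightarrow> 'b::real_normed_vector) \<Rightarrow> bool" where
  "Ck_on 0 S f \<longleftrightarrow> continuous_on S f"
| "Ck_on (Suc k) S f \<longleftrightarrow>
     (\<exists>f'. (\<forall>x\<in>S. (f has_derivative f' x) (at x within S)) \<and> (\<forall>w. Ck_on k S (\<lambda>x. f' x w)))"

definition smooth_on :: "'a::real_normed_vector set \<Rightarrow> ('a \<Rightarrow> 'b::real_normed_vector) \<Rightarrow> bool" where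
  "smooth_on S f \<longleftrightarrow> (\<forall>k. Ck_on k S f)"

definition velocity :: "real \<Rightarrow> real \<Rightarrow> (real \<Rightarrow> 'b::real_normed_vector) \<Rightarrow> real \<Rightarrow> 'b" where
  "velocity a b f t = vector_derivative f (at t within {a..b})"


definition lorentz :: "real^3 \<Rightarrow> real^3 \<Rightarrow> real" where
  "lorentz p q = p$1 * q$1 + p$2 * q$2 - p$3 * q$3"

definition lorentz_cross :: "real^3 \<Rightarrow> real^3 \<Rightarrow> real^3" where
  "lorentz_cross p q = vector [p$2 * q$3 - p$3 * q$2, p$3 * q$1 - p$1 * q$3, - (p$1 * q$2 - p$2 * q$1)]"

lemma lorentz_lorentz_cross: "lorentz (lorentz_cross p q) r = det (vector [p, q, r])"
  by (simp add: lorentz_def lorentz_cross_def det_3 algebra_simps)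

lemma lorentz_cross_unique:
  assumes "\<And>r. lorentz x r = det (vector [p, q, r])"
  shows "x = lorentz_cross p q"
proof -
  have "lorentz x (axis k 1) = lorentz (lorentz_cross p q) (axis k 1)" for k
    using assms by (simp add: lorentz_lorentz_cross)
  from this[of 1] this[of 2] this[of 3] show ?thesis
    by (simp add: lorentz_def vec_eq_iff forall_3 axis_def)
qed

definition de_sitter :: "(real^3) set" where
  "de_sitter = {p. lorentz p p = 1}"

definition de_sitter_xy_pos :: "(real^3) set" where
  "de_sitter_xy_pos = {p \<in> de_sitter. p$3 > 0}"

definition Psi :: "real \<times> real \<Rightarrow> real^3" where
  "Psi = (\<lambda>(u, v). vector [cosh u * cos v, cosh u * sin v, sinh u])"

definition param_curve :: "(real \<Rightarrow> real) \<Rightarrow> (real \<Rightarrow> real) \<Rightarrow> real \<Rightarrow> real^3" where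
  "param_curve u v t = Psi (u t, v t)"

definition spacelike :: "real \<Rightarrow> real \<Rightarrow> (real \<Rightarrow> real^3) \<Rightarrow> bool" where
  "spacelike a b \<gamma> \<longleftrightarrow> (\<forall>t\<in>{a..b}. lorentz (velocity a b \<gamma> t) (velocity a b \<gamma> t) > 0)"

definition timelike :: "real \<Rightarrow> real \<Rightarrow> (real \<Rightarrow> real^3) \<Rightarrow> bool" where
  "timelike a b \<gamma> \<longleftrightarrow> (\<forall>t\<in>{a..b}. lorentz (velocity a b \<gamma> t) (velocity a b \<gamma> t) < 0)"

definition nondegenerate :: "real \<Rightarrow> real \<Rightarrow> (real \<Rightarrow> real^3) \<Rightarrow> bool" where
  "nondegenerate a b \<gamma> \<longleftrightarrow> spacelike a b \<gamma> \<or> timelike a b \<gamma>"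

text \<open>The sign \<open>\<epsilon>\<close>; meaningful for non-degenerate curves only.\<close>

definition causal_sign :: "real \<Rightarrow> real \<Rightarrow> (real \<Rightarrow> real^3) \<Rightarrow> real" where
  "causal_sign a b \<gamma> = (if spacelike a b \<gamma> then 1 else -1)"

definition speed :: "real \<Rightarrow> real \<Rightarrow> (real \<Rightarrow> real^3) \<Rightarrow> real \<Rightarrow> real" where
  "speed a b \<gamma> t = sqrt (causal_sign a b \<gamma> * lorentz (velocity a b \<gamma> t) (velocity a b \<gamma> t))"

definition xi :: "real^3 \<Rightarrow> real^3" where
  "xi p = - p"

definition curvature :: "real \<Rightarrow> real \<Rightarrow> (real \<Rightarrow> real^3) \<Rightarrow> real \<Rightarrow> real" where
  "curvature a b \<gamma> t =
     causal_sign a b \<gamma> *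
     lorentz (velocity a b (velocity a b \<gamma>) t) (lorentz_cross (velocity a b \<gamma> t) (xi (\<gamma> t))) /
     (speed a b \<gamma> t) ^ 3"

definition principal_normal :: "real \<Rightarrow> real \<Rightarrow> (real \<Rightarrow> real^3) \<Rightarrow> real \<Rightarrow> real^3" where
  "principal_normal a b \<gamma> t =
     (1 / speed a b \<gamma> t) *\<^sub>R lorentz_cross (xi (\<gamma> t)) (velocity a b \<gamma> t)"

definition Z :: "real^3" where
  "Z = vector [0, 0, 1]"

text \<open>Distance to the plane \<open>z = 0\<close>, for points with \<open>z > 0\<close>: the Lorentzian length
  \<open>sqrt \<bar>\<langle>w, w\<rangle>\<bar>\<close> of the component \<open>w = (0, 0, z)\<close> orthogonal to the plane.\<close>

definition dist_xy :: "real^3 \<Rightarrow> real" where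
  "dist_xy p = p$3"

definition energy_xy :: "real \<Rightarrow> real \<Rightarrow> real \<Rightarrow> (real \<Rightarrow> real) \<Rightarrow> (real \<Rightarrow> real) \<Rightarrow> real" where
  "energy_xy lam a b u v =
     integral {a..b} (\<lambda>t. (sinh (u t) + lam) *
       sqrt (causal_sign a b (param_curve u v) *
             ((velocity a b v t)\<^sup>2 * (cosh (u t))\<^sup>2 - (velocity a b u t)\<^sup>2)))"

text \<open>Smooth one-parameter families of non-degenerate curves \<open>\<Psi>(U s, V s)\<close> in the region
  \<open>z > 0\<close>, with the same endpoints, through the curve \<open>\<Psi>(u, v)\<close> at \<open>s = 0\<close>. The causal sign
  cannot change along such a family, by continuity.\<close>

definition admissible_variation ::
  "real \<Rightarrow> real \<Rightarrow> (real \<Rightarrow> real) \<Rightarrow> (real \<Rightarrow> real) \<Rightarrow> real \<Rightarrow>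
   (real \<Rightarrow> real \<Rightarrow> real) \<Rightarrow> (real \<Rightarrow> real \<Rightarrow> real) \<Rightarrow> bool" where
  "admissible_variation a b u v \<delta> U V \<longleftrightarrow>
     \<delta> > 0 \<and>
     smooth_on ({-\<delta><..<\<delta>} \<times> {a..b}) (\<lambda>(s, t). U s t) \<and>
     smooth_on ({-\<delta><..<\<delta>} \<times> {a..b}) (\<lambda>(s, t). V s t) \<and>
     (\<forall>t\<in>{a..b}. U 0 t = u t \<and> V 0 t = v t) \<and>
     (\<forall>s\<in>{-\<delta><..<\<delta>}.
        nondegenerate a b (param_curve (U s) (V s)) \<and>
        (\<forall>t\<in>{a..b}. param_curve (U s) (V s) t \<in> de_sitter_xy_pos) \<and>
        param_curve (U s) (V s) a = param_curve u v a \<and>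
        param_curve (U s) (V s) b = param_curve u v b)"

text \<open>Critical points of the energy: the first variation vanishes.\<close>

definition catenary_xy :: "real \<Rightarrow> real \<Rightarrow> real \<Rightarrow> (real \<Rightarrow> real) \<Rightarrow> (real \<Rightarrow> real) \<Rightarrow> bool" where
  "catenary_xy lam a b u v \<longleftrightarrow>
     (\<forall>\<delta> U V. admissible_variation a b u v \<delta> U V \<longrightarrow>
        ((\<lambda>s. energy_xy lam a b (U s) (V s)) has_real_derivative 0) (at 0))"

end

theory Submission
  imports Defs
begin

text \<open>The energy does not depend on the parametrization, so its two Euler--Lagrange expressions are
  \<open>v'\<close> and \<open>- u'\<close> times one common function, which vanishes exactly where
  \<open>\<kappa> (d + \<lambda>) = \<langle>n, Z\<rangle>\<close>. Up to positive factors that function is a polynomial \<open>M\<close> in \<open>cosh u\<close>, \<open>sinh u\<close>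
  and the derivatives of \<open>u\<close> and \<open>v\<close>, hence smooth. The first variation along \<open>(\<eta>, \<zeta>)\<close> is therefore
  the integral of a positive weight times \<open>M (v' \<eta> - u' \<zeta>)\<close>; it is zero if \<open>M = 0\<close>, and conversely the
  field \<open>(\<eta>, \<zeta>) = (t - a) (b - t) M (v', - u')\<close> is itself admissible and makes the integrand
  nonnegative, which forces \<open>M = 0\<close>.\<close>

subsection \<open>Closure properties of smooth functions\<close>

lemma Ck_on_SucI:
  assumes "\<And>x. x \<in> S \<Longrightarrow> (f has_derivative f' x) (at x within S)"
    and "\<And>w. Ck_on k S (\<lambda>x. f' x w)"
  shows "Ck_on (Suc k) S f"
  using assms by auto

lemma Ck_on_SucE:
  assumes "Ck_on (Suc k) S f"
  obtains f' where "\<And>x. x \<in> S \<Longrightarrow> (f has_derivative f' x) (at x within S)"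
    and "\<And>w. Ck_on k S (\<lambda>x. f' x w)"
proof -
  from assms obtain f' where f': "\<forall>x\<in>S. (f has_derivative f' x) (at x within S)"
    "\<forall>w. Ck_on k S (\<lambda>x. f' x w)"
    unfolding Ck_on.simps by (elim exE conjE)
  show ?thesis by (rule that[OF bspec[OF f'(1)] spec[OF f'(2)]])
qed

text \<open>All derivatives are taken within \<open>S\<close>, so agreement on \<open>S\<close>
  alone is enough. This is what \<open>velocity\<close> needs, whose values are known only on the
  interval.\<close>

lemma Ck_on_cong:
  assumes "Ck_on k S f" "\<And>x. x \<in> S \<Longrightarrow> g x = f x"
  shows "Ck_on k S g"
proof (cases k)
  case 0
  then show ?thesis using assms by (simp cong: continuous_on_cong)
next
  case (Suc j)
  then show ?thesis
    using assms by (auto intro: has_derivative_transform[of _ _ g f])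
qed

text \<open>In the product and chain rules a derivative of order \<open>k\<close> is multiplied by
  an undifferentiated factor of order \<open>Suc k\<close>; the order of that factor has to be
  lowered before the induction hypothesis applies.\<close>

lemma Ck_on_Suc_imp: "Ck_on (Suc k) S f \<Longrightarrow> Ck_on k S f"
proof (induction k arbitrary: f)
  case 0
  then show ?case
    by (auto simp: continuous_on_eq_continuous_within intro: has_derivative_continuous)
next
  case (Suc k)
  then show ?case
    using Ck_on.simps(2) by metis
qed

lemma Ck_on_const: "Ck_on k S (\<lambda>x. c)"
proof (induction k arbitrary: c)
  case (Suc k)
  show ?case
    by (rule Ck_on_SucI[where f'="\<lambda>x w. 0"]) (use Suc in auto)
qed simp

lemma Ck_on_bounded_linear:
  assumes "bounded_linear L"
  shows "Ck_on k S L"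
proof (cases k)
  case 0
  then show ?thesis using assms by (simp add: linear_continuous_on)
next
  case (Suc j)
  have "Ck_on (Suc j) S L"
    by (rule Ck_on_SucI[where f'="\<lambda>x. L"]) (auto intro: bounded_linear_imp_has_derivative assms Ck_on_const)
  then show ?thesis using Suc by simp
qed

lemma Ck_on_add:
  "Ck_on k S f \<Longrightarrow> Ck_on k S g \<Longrightarrow> Ck_on k S (\<lambda>x. f x + g x)"
proof (induction k arbitrary: f g)
  case 0
  then show ?case by (simp add: continuous_on_add)
next
  case (Suc k)
  from Suc.prems(1) obtain f' where f: "\<And>x. x \<in> S \<Longrightarrow> (f has_derivative f' x) (at x within S)"
    "\<And>w. Ck_on k S (\<lambda>x. f' x w)" by auto
  from Suc.prems(2) obtain g' where g: "\<And>x. x \<in> S \<Longrightarrow> (g has_derivative g' x) (at x within S)"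
    "\<And>w. Ck_on k S (\<lambda>x. g' x w)" by auto
  show ?case
    by (rule Ck_on_SucI[where f'="\<lambda>x w. f' x w + g' x w"])
      (auto intro: has_derivative_add f g Suc.IH)
qed

lemma Ck_on_mult:
  fixes f g :: "'a::real_normed_vector \<Rightarrow> real"
  shows "Ck_on k S f \<Longrightarrow> Ck_on k S g \<Longrightarrow> Ck_on k S (\<lambda>x. f x * g x)"
proof (induction k arbitrary: f g)
  case 0
  then show ?case by (simp add: continuous_on_mult)
next
  case (Suc k)
  from Suc.prems(1) obtain f' where f: "\<And>x. x \<in> S \<Longrightarrow> (f has_derivative f' x) (at x within S)"
    "\<And>w. Ck_on k S (\<lambda>x. f' x w)" by auto
  from Suc.prems(2) obtain g' where g: "\<And>x. x \<in> S \<Longrightarrow> (g has_derivative g' x) (at x within S)"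
    "\<And>w. Ck_on k S (\<lambda>x. g' x w)" by auto
  show ?case
    by (rule Ck_on_SucI[where f'="\<lambda>x w. f x * g' x w + f' x w * g x"])
      (auto intro!: has_derivative_mult Ck_on_add f g Suc.IH Suc.prems[THEN Ck_on_Suc_imp])
qed

text \<open>Each of the two functions is the derivative of the other, so the induction has to carry
  both.\<close>

lemma Ck_on_cosh_sinh:
  fixes f :: "'a::real_normed_vector \<Rightarrow> real"
  shows "Ck_on k S f \<Longrightarrow> Ck_on k S (\<lambda>x. cosh (f x)) \<and> Ck_on k S (\<lambda>x. sinh (f x))"
proof (induction k)
  case 0
  then show ?case by (auto intro: continuous_intros)
next
  case (Suc k)
  from Suc.prems obtain f' where f: "\<And>x. x \<in> S \<Longrightarrow> (f has_derivative f' x) (at x within S)"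
    "\<And>w. Ck_on k S (\<lambda>x. f' x w)" by auto
  have IH: "Ck_on k S (\<lambda>x. cosh (f x))" "Ck_on k S (\<lambda>x. sinh (f x))"
    using Suc.IH[OF Ck_on_Suc_imp[OF Suc.prems]] by auto
  have "(cosh has_real_derivative sinh y) (at y)" "(sinh has_real_derivative cosh y) (at y)" for y :: real
    by (auto intro!: derivative_eq_intros)
  note d = this[THEN DERIV_compose_FDERIV]
  have "Ck_on (Suc k) S (\<lambda>x. cosh (f x))"
    by (rule Ck_on_SucI[OF d(1)[OF f(1)]]) (auto intro: Ck_on_mult IH f(2))
  moreover have "Ck_on (Suc k) S (\<lambda>x. sinh (f x))"
    by (rule Ck_on_SucI[OF d(2)[OF f(1)]]) (auto intro: Ck_on_mult IH f(2))
  ultimately show ?case by simp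
qed

text \<open>Lifts a function of the curve parameter to the strip; with \<open>smooth_on_fst\<close>
  this makes variations of the form \<open>u t + s * \<eta> t\<close> smooth.\<close>

lemma Ck_on_comp_snd:
  "Ck_on k T f \<Longrightarrow> Ck_on k (A \<times> T) (\<lambda>x. f (snd x))"
proof (induction k arbitrary: f)
  case 0
  then show ?case
    by (auto intro!: continuous_on_compose2[of T f] continuous_intros)
next
  case (Suc k)
  from Suc.prems obtain f' where f: "\<And>x. x \<in> T \<Longrightarrow> (f has_derivative f' x) (at x within T)"
    "\<And>w. Ck_on k T (\<lambda>x. f' x w)" by auto
  have "((\<lambda>x. f (snd x)) has_derivative (\<lambda>w. f' (snd x) (snd w))) (at x within A \<times> T)"
    if "x \<in> A \<times> T" for x
    by (rule has_derivative_in_compose2[where t=T and g=f and g'=f'])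
      (use that f in \<open>auto intro!: derivative_intros\<close>)
  then show ?case
    by (intro Ck_on_SucI[where f'="\<lambda>x w. f' (snd x) (snd w)"]) (auto intro: Suc.IH f)
qed

section \<open>Calculus of smooth functions\<close>

named_theorems smooth_intros

lemma smooth_on_const [smooth_intros]: "smooth_on S (\<lambda>x. c)"
  by (simp add: smooth_on_def Ck_on_const)

lemma smooth_on_fst [smooth_intros]: "smooth_on S fst"
  by (simp add: smooth_on_def Ck_on_bounded_linear bounded_linear_fst)

lemma smooth_on_id [smooth_intros]: "smooth_on S (\<lambda>x. x)"
  by (simp add: smooth_on_def Ck_on_bounded_linear)

lemma smooth_on_add [smooth_intros]:
  "smooth_on S f \<Longrightarrow> smooth_on S g \<Longrightarrow> smooth_on S (\<lambda>x. f x + g x)"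
  by (simp add: smooth_on_def Ck_on_add)

lemma smooth_on_mult [smooth_intros]:
  fixes f g :: "'a::real_normed_vector \<Rightarrow> real"
  shows "smooth_on S f \<Longrightarrow> smooth_on S g \<Longrightarrow> smooth_on S (\<lambda>x. f x * g x)"
  by (simp add: smooth_on_def Ck_on_mult)

lemma smooth_on_diff [smooth_intros]:
  fixes f g :: "'a::real_normed_vector \<Rightarrow> real"
  assumes "smooth_on S f" "smooth_on S g"
  shows "smooth_on S (\<lambda>x. f x - g x)"
  using smooth_on_add[OF assms(1) smooth_on_mult[OF smooth_on_const[of S "-1"] assms(2)]] by simp

lemma smooth_on_power [smooth_intros]:
  fixes f :: "'a::real_normed_vector \<Rightarrow> real"
  shows "smooth_on S f \<Longrightarrow> smooth_on S (\<lambda>x. f x ^ n)"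
  by (induction n) (auto intro: smooth_intros)

lemma smooth_on_cosh [smooth_intros]:
  fixes f :: "'a::real_normed_vector \<Rightarrow> real"
  shows "smooth_on S f \<Longrightarrow> smooth_on S (\<lambda>x. cosh (f x))"
  by (simp add: smooth_on_def Ck_on_cosh_sinh)

lemma smooth_on_sinh [smooth_intros]:
  fixes f :: "'a::real_normed_vector \<Rightarrow> real"
  shows "smooth_on S f \<Longrightarrow> smooth_on S (\<lambda>x. sinh (f x))"
  by (simp add: smooth_on_def Ck_on_cosh_sinh)

lemma smooth_on_comp_snd [smooth_intros]:
  "smooth_on T f \<Longrightarrow> smooth_on (A \<times> T) (\<lambda>x. f (snd x))"
  by (simp add: smooth_on_def Ck_on_comp_snd)

lemma smooth_on_imp_continuous_on: "smooth_on S f \<Longrightarrow> continuous_on S f"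
  unfolding smooth_on_def by (metis Ck_on.simps(1))

section \<open>Velocities on a closed interval\<close>

lemma velocity_eqI:
  fixes f :: "real \<Rightarrow> 'a::real_normed_vector"
  assumes "a < b" "t \<in> {a..b}" "(f has_vector_derivative f') (at t within {a..b})"
  shows "velocity a b f t = f'"
  unfolding velocity_def
  \<comment> \<open>Since \<open>a < b\<close>, every point of the interval is a limit point of it,
    which makes the derivative within the interval unique, also at the ends.\<close>
  by (rule vector_derivative_within) (use assms in \<open>auto simp: trivial_limit_within islimpt_Icc\<close>)

lemma has_vector_derivative_velocity:
  fixes f :: "real \<Rightarrow> 'a::real_normed_vector"
  assumes "smooth_on {a..b} f" "t \<in> {a..b}"
  shows "(f has_vector_derivative velocity a b f t) (at t within {a..b})"
proof -
  have "Ck_on (Suc 0) {a..b} f" using assms unfolding smooth_on_def by blast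
  then have "f differentiable (at t within {a..b})"
    using assms(2) unfolding differentiable_def by auto
  then show ?thesis
    unfolding velocity_def by (simp add: vector_derivative_works)
qed

lemma has_real_derivative_velocity:
  assumes "smooth_on {a..b} f" "t \<in> {a..b}"
  shows "(f has_real_derivative velocity a b f t) (at t within {a..b})"
  using has_vector_derivative_velocity[OF assms]
  by (simp add: has_real_derivative_iff_has_vector_derivative)

lemma smooth_on_velocity:
  fixes f :: "real \<Rightarrow> 'a::real_normed_vector"
  assumes "a < b" "smooth_on {a..b} f"
  shows "smooth_on {a..b} (velocity a b f)"
  unfolding smooth_on_def
proof
  fix k
  have "Ck_on (Suc k) {a..b} f" using assms unfolding smooth_on_def by blast
  then obtain f' where f: "\<And>x. x \<in> {a..b} \<Longrightarrow> (f has_derivative f' x) (at x within {a..b})"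
    "\<And>w. Ck_on k {a..b} (\<lambda>x. f' x w)" by (rule Ck_on_SucE) (rule that)
  \<comment> \<open>A linear map on the reals is determined by its value at 1, so the velocity is
    the derivative in direction 1, which has order \<open>k\<close> by the choice of
    \<open>f'\<close>.\<close>
  have "velocity a b f t = f' t 1" if "t \<in> {a..b}" for t
  proof (rule velocity_eqI[OF assms(1) that])
    have "linear (f' t)" by (rule has_derivative_linear[OF f(1)[OF that]])
    then have "x *\<^sub>R f' t 1 = f' t x" for x
      using linear_scale[of "f' t" x 1] by simp
    then show "(f has_vector_derivative f' t 1) (at t within {a..b})"
      using f(1)[OF that] by (simp only: has_vector_derivative_def)
  qed
  then show "Ck_on k {a..b} (velocity a b f)"
    by (rule Ck_on_cong[OF f(2)[of 1]])
qed

subsection \<open>Partial derivatives on a strip\<close>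

text \<open>The total derivative is restricted to a line parallel to the first axis. The line stays
  in the product because \<open>t \<in> J\<close>, so boundary points of \<open>J\<close> are
  covered too.\<close>

lemma has_derivative_partial_fst:
  fixes F :: "real \<times> real \<Rightarrow> real"
  assumes F: "(F has_derivative F') (at (s, t) within I \<times> J)" and "t \<in> J"
  shows "((\<lambda>s. F (s, t)) has_real_derivative F' (1, 0)) (at s within I)"
proof -
  have "((\<lambda>s. F (s, t)) has_derivative (\<lambda>h. F' (h, 0))) (at s within I)"
  proof (rule has_derivative_in_compose[where f="\<lambda>s. (s, t)" and g=F])
    show "((\<lambda>s. (s, t)) has_derivative (\<lambda>h. (h, 0))) (at s within I)"
      by (auto intro!: derivative_eq_intros)
    show "(F has_derivative F') (at (s, t) within (\<lambda>s. (s, t)) ` I)"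
      by (rule has_derivative_subset[OF F]) (use assms(2) in auto)
  qed
  moreover have "(\<lambda>h. F' (h, 0)) = (*) (F' (1, 0))"
  proof
    fix h show "F' (h, 0) = F' (1, 0) * h"
      using linear_scale[OF has_derivative_linear[OF F], of h "(1, 0)"] by simp
  qed
  ultimately show ?thesis
    by (simp only: has_field_derivative_def)
qed

lemma has_derivative_partial_snd:
  fixes F :: "real \<times> real \<Rightarrow> real"
  assumes F: "(F has_derivative F') (at (s, t) within I \<times> J)" and "s \<in> I"
  shows "((\<lambda>t. F (s, t)) has_real_derivative F' (0, 1)) (at t within J)"
proof -
  have "((\<lambda>t. F (s, t)) has_derivative (\<lambda>h. F' (0, h))) (at t within J)"
  proof (rule has_derivative_in_compose[where f="\<lambda>t. (s, t)" and g=F])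
    show "((\<lambda>t. (s, t)) has_derivative (\<lambda>h. (0, h))) (at t within J)"
      by (auto intro!: derivative_eq_intros)
    show "(F has_derivative F') (at (s, t) within (\<lambda>t. (s, t)) ` J)"
      by (rule has_derivative_subset[OF F]) (use assms(2) in auto)
  qed
  moreover have "(\<lambda>h. F' (0, h)) = (*) (F' (0, 1))"
  proof
    fix h show "F' (0, h) = F' (0, 1) * h"
      using linear_scale[OF has_derivative_linear[OF F], of h "(0, 1)"] by simp
  qed
  ultimately show ?thesis
    by (simp only: has_field_derivative_def)
qed

lemma continuous_on_slice:
  assumes "continuous_on (I \<times> J) (\<lambda>(s, t). f s t)" "s \<in> I"
  shows "continuous_on J (f s)"
proof -
  have "continuous_on J (\<lambda>t. (\<lambda>(s, t). f s t) (s, t))"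
    by (rule continuous_on_compose2[OF assms(1)]) (use assms(2) in \<open>auto intro: continuous_intros\<close>)
  then show ?thesis by simp
qed

text \<open>Differentiating \<open>U s t - U s a = \<integral> \<partial>\<^sub>t U\<close> in \<open>s\<close> under the integral sign makes
  Schwarz's theorem available up to the boundary of the strip.\<close>

lemma mixed_partials_commute:
  fixes U Us Ut Ust :: "real \<Rightarrow> real \<Rightarrow> real"
  assumes "open I" "convex I" "s \<in> I" "t \<in> {a..b}"
    and s: "\<And>s t. s \<in> I \<Longrightarrow> t \<in> {a..b} \<Longrightarrow> ((\<lambda>s. U s t) has_real_derivative Us s t) (at s)"
    and t: "\<And>s t. s \<in> I \<Longrightarrow> t \<in> {a..b} \<Longrightarrow> (U s has_real_derivative Ut s t) (at t within {a..b})"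
    and ts: "\<And>s t. s \<in> I \<Longrightarrow> t \<in> {a..b} \<Longrightarrow> ((\<lambda>s. Ut s t) has_real_derivative Ust s t) (at s)"
    and Ut: "continuous_on (I \<times> {a..b}) (\<lambda>(s, t). Ut s t)"
    and Ust: "continuous_on (I \<times> {a..b}) (\<lambda>(s, t). Ust s t)"
  shows "(Us s has_real_derivative Ust s t) (at t within {a..b})"
proof -
  have Us: "Us s r = Us s a + integral {a..r} (Ust s)" if r: "r \<in> {a..b}" for r
  proof -
    have sub: "I \<times> {a..r} \<subseteq> I \<times> {a..b}" using r by auto
    have "((\<lambda>s. integral (cbox a r) (Ut s)) has_real_derivative integral (cbox a r) (Ust s)) (at s within I)"
    proof (rule leibniz_rule_field_derivative)
      show "((\<lambda>s. Ut s q) has_real_derivative Ust s q) (at s within I)" if "s \<in> I" "q \<in> cbox a r" for s q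
        using ts[of s q] that r by (auto intro: has_field_derivative_at_within)
      show "Ut s integrable_on cbox a r" if "s \<in> I" for s
        using continuous_on_slice[OF continuous_on_subset[OF Ut sub] that]
        by (simp add: integrable_continuous_real)
      show "continuous_on (I \<times> cbox a r) (\<lambda>(s, t). Ust s t)"
        using continuous_on_subset[OF Ust sub] by simp
    qed (use assms in auto)
    then have "((\<lambda>s. integral {a..r} (Ut s)) has_real_derivative integral {a..r} (Ust s)) (at s)"
      by (simp only: at_within_open[OF \<open>s \<in> I\<close> \<open>open I\<close>] box_real)
    moreover have "integral {a..r} (Ut q) = U q r - U q a" if "q \<in> I" for q
    proof (rule integral_unique, rule fundamental_theorem_of_calculus)
      show "a \<le> r" using r by simp
      fix x assume "x \<in> {a..r}"
      then have "(U q has_real_derivative Ut q x) (at x within {a..b})" using t[OF that] r by simp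
      then have "(U q has_real_derivative Ut q x) (at x within {a..r})"
        by (rule DERIV_subset) (use r in auto)
      then show "(U q has_vector_derivative Ut q x) (at x within {a..r})"
        by (simp only: has_real_derivative_iff_has_vector_derivative)
    qed
    ultimately have "((\<lambda>s. U s r - U s a) has_real_derivative integral {a..r} (Ust s)) (at s)"
      by (rule has_field_derivative_transform_within_open[OF _ \<open>open I\<close> \<open>s \<in> I\<close>])
    moreover have "((\<lambda>s. U s r - U s a) has_real_derivative Us s r - Us s a) (at s)"
      by (intro DERIV_diff s) (use r \<open>s \<in> I\<close> in auto)
    ultimately have "integral {a..r} (Ust s) = Us s r - Us s a" by (rule DERIV_unique)
    then show ?thesis by simp
  qed
  \<comment> \<open>By the formula just proved, \<open>Us s\<close> is a constant plus an integral
    with variable upper limit, so its derivative is the continuous integrand.\<close>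
  have "((\<lambda>r. integral {a..r} (Ust s)) has_real_derivative Ust s t) (at t within {a..b})"
    using continuous_on_slice[OF Ust \<open>s \<in> I\<close>] \<open>t \<in> {a..b}\<close>
    by (rule integral_has_real_derivative)
  then have "((\<lambda>r. Us s a + integral {a..r} (Ust s)) has_real_derivative Ust s t) (at t within {a..b})"
    by (auto intro!: derivative_eq_intros)
  from has_derivative_transform[OF \<open>t \<in> {a..b}\<close> Us this[unfolded has_field_derivative_def]]
  show ?thesis by (simp only: has_field_derivative_def)
qed

text \<open>Collects what differentiation under the integral and integration by parts require. Order
  two suffices: \<open>F\<close> is the derivative of the function, \<open>G\<close> that of its
  partial derivative in \<open>t\<close>. The mixed partial is first the \<open>s\<close>-derivative
  of \<open>Ut\<close>; \<open>mixed_partials_commute\<close> makes it the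
  \<open>t\<close>-derivative of \<open>Us\<close> as well.\<close>

lemma smooth_on_strip_partials:
  fixes U :: "real \<Rightarrow> real \<Rightarrow> real"
  assumes "smooth_on ({-\<delta><..<\<delta>} \<times> {a..b}) (\<lambda>(s, t). U s t)"
  obtains Us Ut Ust where
    "\<And>s t. s \<in> {-\<delta><..<\<delta>} \<Longrightarrow> t \<in> {a..b} \<Longrightarrow> ((\<lambda>s. U s t) has_real_derivative Us s t) (at s)"
    "\<And>s t. s \<in> {-\<delta><..<\<delta>} \<Longrightarrow> t \<in> {a..b} \<Longrightarrow> (U s has_real_derivative Ut s t) (at t within {a..b})"
    "\<And>s t. s \<in> {-\<delta><..<\<delta>} \<Longrightarrow> t \<in> {a..b} \<Longrightarrow> ((\<lambda>s. Ut s t) has_real_derivative Ust s t) (at s)"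
    "\<And>s t. s \<in> {-\<delta><..<\<delta>} \<Longrightarrow> t \<in> {a..b} \<Longrightarrow> (Us s has_real_derivative Ust s t) (at t within {a..b})"
    "continuous_on ({-\<delta><..<\<delta>} \<times> {a..b}) (\<lambda>(s, t). U s t)"
    "continuous_on ({-\<delta><..<\<delta>} \<times> {a..b}) (\<lambda>(s, t). Us s t)"
    "continuous_on ({-\<delta><..<\<delta>} \<times> {a..b}) (\<lambda>(s, t). Ut s t)"
    "continuous_on ({-\<delta><..<\<delta>} \<times> {a..b}) (\<lambda>(s, t). Ust s t)"
proof -
  let ?I = "{-\<delta><..<\<delta>}" and ?J = "{a..b}"
  have within: "at s within ?I = at s" if "s \<in> ?I" for s :: real
    by (rule at_within_open[OF that open_greaterThanLessThan])
  have "Ck_on (Suc (Suc 0)) (?I \<times> ?J) (\<lambda>(s, t). U s t)"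
    using assms unfolding smooth_on_def by blast
  then obtain F where F: "\<And>x. x \<in> ?I \<times> ?J \<Longrightarrow> ((\<lambda>(s, t). U s t) has_derivative F x) (at x within ?I \<times> ?J)"
    and F1: "\<And>w. Ck_on (Suc 0) (?I \<times> ?J) (\<lambda>x. F x w)"
    by (rule Ck_on_SucE) (rule that)
  from F1[of "(0, 1)"] obtain G
    where G: "\<And>x. x \<in> ?I \<times> ?J \<Longrightarrow> ((\<lambda>x. F x (0, 1)) has_derivative G x) (at x within ?I \<times> ?J)"
      and G1: "\<And>w. Ck_on 0 (?I \<times> ?J) (\<lambda>x. G x w)"
    by (rule Ck_on_SucE) (rule that)
  have F0: "continuous_on (?I \<times> ?J) (\<lambda>x. F x w)" for w
    using Ck_on_Suc_imp[OF F1] by simp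
  define Us where "Us = (\<lambda>s t. F (s, t) (1, 0))"
  define Ut where "Ut = (\<lambda>s t. F (s, t) (0, 1))"
  define Ust where "Ust = (\<lambda>s t. G (s, t) (1, 0))"
  have s: "((\<lambda>s. U s t) has_real_derivative Us s t) (at s)" if "s \<in> ?I" "t \<in> ?J" for s t
    using has_derivative_partial_fst[OF F, of s t] that by (simp add: Us_def within)
  have t: "(U s has_real_derivative Ut s t) (at t within ?J)" if "s \<in> ?I" "t \<in> ?J" for s t
    using has_derivative_partial_snd[OF F, of s t] that by (simp add: Ut_def)
  have ts: "((\<lambda>s. Ut s t) has_real_derivative Ust s t) (at s)" if "s \<in> ?I" "t \<in> ?J" for s t
    using has_derivative_partial_fst[OF G, of s t] that by (simp add: Ut_def Ust_def within)
  have cU: "continuous_on (?I \<times> ?J) (\<lambda>(s, t). U s t)"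
    using assms by (rule smooth_on_imp_continuous_on)
  have cUs: "continuous_on (?I \<times> ?J) (\<lambda>(s, t). Us s t)"
    using F0[of "(1, 0)"] by (simp add: Us_def case_prod_beta')
  have cUt: "continuous_on (?I \<times> ?J) (\<lambda>(s, t). Ut s t)"
    using F0[of "(0, 1)"] by (simp add: Ut_def case_prod_beta')
  have cUst: "continuous_on (?I \<times> ?J) (\<lambda>(s, t). Ust s t)"
    using G1[of "(1, 0)"] by (simp add: Ust_def case_prod_beta')
  have st: "(Us s has_real_derivative Ust s t) (at t within ?J)" if "s \<in> ?I" "t \<in> ?J" for s t
    by (rule mixed_partials_commute[OF _ _ that s t ts cUt cUst]) auto
  show ?thesis
    by (rule that[OF s t ts st cU cUs cUt cUst])
qed

text \<open>Compactness gives a bound on \<open>s\<close> that is uniform in \<open>t\<close>: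
  \<open>g\<close> has a positive minimum on the slice \<open>s = 0\<close>, and by uniform
  continuity it changes by less than this minimum nearby. It shows that small variations keep the
  open conditions on the curve.\<close>

lemma positive_near_slice:
  fixes g :: "real \<times> real \<Rightarrow> real"
  assumes g: "continuous_on (UNIV \<times> {a..b}) g" and pos: "\<And>t. t \<in> {a..b} \<Longrightarrow> g (0, t) > 0"
  obtains \<delta> where "\<delta> > 0" "\<And>s t. s \<in> {-\<delta><..<\<delta>} \<Longrightarrow> t \<in> {a..b} \<Longrightarrow> g (s, t) > 0"
proof -
  \<comment> \<open>The range of \<open>s\<close> is cut at 1 only to make the domain compact; hence
    the minimum of 1 and \<open>d\<close> below.\<close>
  let ?K = "{-1..1::real} \<times> {a..b}"
  have "uniformly_continuous_on ?K g"
    by (intro compact_uniformly_continuous compact_Times continuous_on_subset[OF g]) auto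
  show ?thesis
  proof (cases "{a..b} = {}")
    case True
    then show ?thesis using that[of 1] by auto
  next
    case False
    have "continuous_on {a..b} (\<lambda>t. g (0, t))"
      by (rule continuous_on_compose2[OF g]) (auto intro!: continuous_intros)
    then obtain t0 where t0: "t0 \<in> {a..b}" "\<And>t. t \<in> {a..b} \<Longrightarrow> g (0, t0) \<le> g (0, t)"
      using continuous_attains_inf[OF compact_Icc False] by meson
    have "g (0, t0) > 0" using pos t0(1) by simp
    then obtain d where d: "d > 0"
      "\<And>x y. x \<in> ?K \<Longrightarrow> y \<in> ?K \<Longrightarrow> dist y x < d \<Longrightarrow> dist (g y) (g x) < g (0, t0)"
      using \<open>uniformly_continuous_on ?K g\<close> unfolding uniformly_continuous_on_def by meson
    show ?thesis
    proof (rule that[of "min 1 d"])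
      fix s t :: real assume st: "s \<in> {- min 1 d<..<min 1 d}" "t \<in> {a..b}"
      have "dist (g (s, t)) (g (0, t)) < g (0, t0)"
        by (rule d(2)) (use st in \<open>auto simp: dist_Pair_Pair\<close>)
      then show "g (s, t) > 0" using t0(2)[OF st(2)] by (simp add: dist_real_def)
    qed (use d in auto)
  qed
qed

subsection \<open>Curves on the de Sitter plane\<close>

lemma has_vector_derivative_vector_3:
  assumes "(x has_real_derivative x') F" "(y has_real_derivative y') F" "(z has_real_derivative z') F"
  shows "((\<lambda>t. vector [x t, y t, z t] :: real^3) has_vector_derivative vector [x', y', z']) F"
proof -
  have eq: "(vector [p, q, r] :: real^3) = p *\<^sub>R axis 1 1 + q *\<^sub>R axis 2 1 + r *\<^sub>R axis 3 1" for p q r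
    by (simp add: vec_eq_iff forall_3 axis_def)
  show ?thesis
    unfolding eq using assms[unfolded has_real_derivative_iff_has_vector_derivative]
    by (intro has_vector_derivative_add
        bounded_linear.has_vector_derivative[OF bounded_linear_scaleR_left])
qed

lemma velocity_param_curve:
  assumes "a < b" "t \<in> {a..b}"
    and u: "(u has_real_derivative u') (at t within {a..b})"
    and v: "(v has_real_derivative v') (at t within {a..b})"
  shows "velocity a b (param_curve u v) t =
    vector [sinh (u t) * u' * cos (v t) - cosh (u t) * sin (v t) * v',
            sinh (u t) * u' * sin (v t) + cosh (u t) * cos (v t) * v',
            cosh (u t) * u']"
proof (rule velocity_eqI[OF assms(1,2)])
  show "(param_curve u v has_vector_derivative
      vector [sinh (u t) * u' * cos (v t) - cosh (u t) * sin (v t) * v',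
              sinh (u t) * u' * sin (v t) + cosh (u t) * cos (v t) * v',
              cosh (u t) * u']) (at t within {a..b})"
    unfolding param_curve_def Psi_def prod.case
    by (rule has_vector_derivative_vector_3) (auto intro!: derivative_eq_intros u v)
qed

text \<open>This is the induced metric in the coordinates of \<open>Psi\<close>; the angle drops out
  because the metric is invariant under rotations about the z-axis.\<close>

lemma lorentz_velocity_param_curve:
  assumes "a < b" "t \<in> {a..b}"
    and "(u has_real_derivative u') (at t within {a..b})"
    and "(v has_real_derivative v') (at t within {a..b})"
  shows "lorentz (velocity a b (param_curve u v) t) (velocity a b (param_curve u v) t) =
    v'\<^sup>2 * (cosh (u t))\<^sup>2 - u'\<^sup>2"
proof -
  \<comment> \<open>Here \<open>s\<close>, \<open>C\<close>, \<open>c\<close>, \<open>S\<close>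
    stand for the sine, cosine, cosh and sinh; the identity is polynomial modulo their two quadratic
    relations.\<close>
  have "(S * u' * C - c * s * v')\<^sup>2 + (S * u' * s + c * C * v')\<^sup>2 - (c * u')\<^sup>2 = v'\<^sup>2 * c\<^sup>2 - u'\<^sup>2"
    if "s\<^sup>2 + C\<^sup>2 = 1" "c\<^sup>2 = S\<^sup>2 + 1" for s C c S :: real
    using that by algebra
  from this[OF sin_cos_squared_add cosh_square_eq, of "u t" "v t"]
  show ?thesis
    by (simp add: velocity_param_curve[OF assms] lorentz_def power2_eq_square)
qed

lemma second_velocity_param_curve:
  assumes "a < b" "smooth_on {a..b} u" "smooth_on {a..b} v" "t \<in> {a..b}"
  defines "u1 \<equiv> velocity a b u" and "v1 \<equiv> velocity a b v"
  defines "u2 \<equiv> velocity a b u1" and "v2 \<equiv> velocity a b v1"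
  shows "velocity a b (velocity a b (param_curve u v)) t =
    vector [cosh (u t) * (u1 t)\<^sup>2 * cos (v t) + sinh (u t) * u2 t * cos (v t)
              - 2 * sinh (u t) * u1 t * sin (v t) * v1 t
              - cosh (u t) * cos (v t) * (v1 t)\<^sup>2 - cosh (u t) * sin (v t) * v2 t,
            cosh (u t) * (u1 t)\<^sup>2 * sin (v t) + sinh (u t) * u2 t * sin (v t)
              + 2 * sinh (u t) * u1 t * cos (v t) * v1 t
              - cosh (u t) * sin (v t) * (v1 t)\<^sup>2 + cosh (u t) * cos (v t) * v2 t,
            sinh (u t) * (u1 t)\<^sup>2 + cosh (u t) * u2 t]" (is "_ = ?acc")
proof (rule velocity_eqI[OF assms(1,4)])
  let ?vel = "\<lambda>t. vector [sinh (u t) * u1 t * cos (v t) - cosh (u t) * sin (v t) * v1 t,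
            sinh (u t) * u1 t * sin (v t) + cosh (u t) * cos (v t) * v1 t,
            cosh (u t) * u1 t] :: real^3"
  have u: "(u has_real_derivative u1 t) (at t within {a..b})"
    and v: "(v has_real_derivative v1 t) (at t within {a..b})" if "t \<in> {a..b}" for t
    using that assms(2,3) unfolding u1_def v1_def by (auto intro: has_real_derivative_velocity)
  have u2: "(u1 has_real_derivative u2 t) (at t within {a..b})"
    and v2: "(v1 has_real_derivative v2 t) (at t within {a..b})"
    using assms(1-4) unfolding u1_def v1_def u2_def v2_def
    by (auto intro: has_real_derivative_velocity smooth_on_velocity)
  note d = u[OF assms(4)] v[OF assms(4)] u2 v2
  have "(?vel has_vector_derivative ?acc) (at t within {a..b})"
    by (rule has_vector_derivative_vector_3)
      (auto intro!: derivative_eq_intros d simp: power2_eq_square algebra_simps)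
  \<comment> \<open>The explicit formula for the velocity holds only on the interval, which is
    enough for a derivative within it.\<close>
  then show "(velocity a b (param_curve u v) has_vector_derivative ?acc) (at t within {a..b})"
    by (rule has_vector_derivative_transform[OF assms(4), rotated])
      (use velocity_param_curve[OF assms(1) _ u v] in auto)
qed

text \<open>Non-degeneracy fixes one sign for the whole curve, so it can be read off at any single
  parameter \<open>t0\<close>. This reduces comparing the signs of neighbouring curves to continuity
  at one point.\<close>

lemma causal_sign_param_curve:
  assumes "a < b" "t0 \<in> {a..b}"
    and "nondegenerate a b (param_curve u v)"
    and "\<And>t. t \<in> {a..b} \<Longrightarrow> (u has_real_derivative u' t) (at t within {a..b})"
    and "\<And>t. t \<in> {a..b} \<Longrightarrow> (v has_real_derivative v' t) (at t within {a..b})"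
  shows "causal_sign a b (param_curve u v) = sgn ((v' t0)\<^sup>2 * (cosh (u t0))\<^sup>2 - (u' t0)\<^sup>2)"
    and "t \<in> {a..b} \<Longrightarrow>
      causal_sign a b (param_curve u v) * ((v' t)\<^sup>2 * (cosh (u t))\<^sup>2 - (u' t)\<^sup>2) > 0"
proof -
  have q: "lorentz (velocity a b (param_curve u v) t) (velocity a b (param_curve u v) t) =
      (v' t)\<^sup>2 * (cosh (u t))\<^sup>2 - (u' t)\<^sup>2" if "t \<in> {a..b}" for t
    using lorentz_velocity_param_curve[OF assms(1) that assms(4,5)[OF that]] .
  have "sgn ((v' t)\<^sup>2 * (cosh (u t))\<^sup>2 - (u' t)\<^sup>2) = causal_sign a b (param_curve u v) \<and>
      causal_sign a b (param_curve u v) * ((v' t)\<^sup>2 * (cosh (u t))\<^sup>2 - (u' t)\<^sup>2) > 0"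
    if t: "t \<in> {a..b}" for t
  proof (cases "spacelike a b (param_curve u v)")
    case True
    then have "(v' t)\<^sup>2 * (cosh (u t))\<^sup>2 - (u' t)\<^sup>2 > 0"
      using q[OF t] t unfolding spacelike_def by metis
    with True show ?thesis by (simp add: causal_sign_def)
  next
    case False
    then have "timelike a b (param_curve u v)" using assms(3) by (simp add: nondegenerate_def)
    then have "(v' t)\<^sup>2 * (cosh (u t))\<^sup>2 - (u' t)\<^sup>2 < 0"
      using q[OF t] t unfolding timelike_def by metis
    with False show ?thesis by (simp add: causal_sign_def)
  qed
  then show "causal_sign a b (param_curve u v) = sgn ((v' t0)\<^sup>2 * (cosh (u t0))\<^sup>2 - (u' t0)\<^sup>2)"
    and "t \<in> {a..b} \<Longrightarrow>
      causal_sign a b (param_curve u v) * ((v' t)\<^sup>2 * (cosh (u t))\<^sup>2 - (u' t)\<^sup>2) > 0"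
    using assms(2) by metis+
qed

text \<open>\<open>Psi\<close> takes all its values in \<open>de_sitter\<close>, so only the height
  \<open>sinh (u t)\<close> matters, and it has the sign of \<open>u t\<close>.\<close>

lemma param_curve_mem_iff: "param_curve u v t \<in> de_sitter_xy_pos \<longleftrightarrow> u t > 0"
proof -
  have "(c * C)\<^sup>2 + (c * s)\<^sup>2 - S\<^sup>2 = 1"
    if "s\<^sup>2 + C\<^sup>2 = 1" "c\<^sup>2 = S\<^sup>2 + 1" for s C c S :: real
    using that by algebra
  from this[OF sin_cos_squared_add cosh_square_eq, of "u t" "v t"]
  show ?thesis
    by (simp add: param_curve_def Psi_def de_sitter_xy_pos_def de_sitter_def lorentz_def
        power2_eq_square)
qed

lemma dist_xy_param_curve: "dist_xy (param_curve u v t) = sinh (u t)"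
  by (simp add: dist_xy_def param_curve_def Psi_def)

subsection \<open>The first variation of the energy\<close>

text \<open>The image of \<open>I\<close> is connected, so two values of opposite sign would force a
  zero between them.\<close>

lemma sgn_eq_of_connected:
  fixes g :: "real \<Rightarrow> real"
  assumes "connected I" "continuous_on I g" "\<And>x. x \<in> I \<Longrightarrow> g x \<noteq> 0" "x \<in> I" "y \<in> I"
  shows "sgn (g x) = sgn (g y)"
proof -
  have *: "\<not> (g p < 0 \<and> 0 < g q)" if "p \<in> I" "q \<in> I" for p q
    using connectedD_interval[OF connected_continuous_image[OF assms(2,1)], of "g p" "g q" 0]
      that assms(3) by force
  show ?thesis
    using *[of x y] *[of y x] assms(3)[of x] assms(3)[of y] assms(4,5)
    by (auto simp: sgn_if)
qed

text \<open>A variation fixes the end points in space, whereas the angle is determined by the point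
  only modulo full turns. The height fixes \<open>U\<close> since sinh is injective; then the cosine
  and sine of \<open>V\<close> are constant, and since they never vanish together, differentiating
  both gives \<open>V' = 0\<close>.\<close>

lemma param_curve_fixed_imp_derivative_zero:
  assumes I: "open I" "s0 \<in> I"
    and p: "\<And>s. s \<in> I \<Longrightarrow> param_curve (U s) (V s) t = p"
    and U: "((\<lambda>s. U s t) has_real_derivative U') (at s0)"
    and V: "((\<lambda>s. V s t) has_real_derivative V') (at s0)"
  shows "U' = 0 \<and> V' = 0"
proof -
  have const: "h' = 0" if "(h has_real_derivative h') (at s0)" "\<And>s. s \<in> I \<Longrightarrow> h s = h s0"
    for h :: "real \<Rightarrow> real" and h'
    by (rule DERIV_unique[OF that(1)], rule has_field_derivative_transform_within_open[OF DERIV_const I])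
      (use that(2) in simp)
  have comp: "cosh (U s t) * cos (V s t) = p $ 1" "cosh (U s t) * sin (V s t) = p $ 2"
      "sinh (U s t) = p $ 3" if "s \<in> I" for s
    using p[OF that] by (auto simp: param_curve_def Psi_def)
  have Us: "U s t = U s0 t" if "s \<in> I" for s
    using comp(3)[OF that] comp(3)[OF I(2)] by (metis arsinh_sinh_real)
  have cs: "cos (V s t) = cos (V s0 t)" "sin (V s t) = sin (V s0 t)" if "s \<in> I" for s
    using comp(1,2)[OF that] comp(1,2)[OF I(2)] unfolding Us[OF that]
    by (metis cosh_real_nonzero mult_left_cancel)+
  have "U' = 0" by (rule const[OF U Us])
  moreover have "- sin (V s0 t) * V' = 0"
    by (rule const[where h="\<lambda>s. cos (V s t)"]) (use cs in \<open>auto intro!: derivative_eq_intros V\<close>)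
  moreover have "cos (V s0 t) * V' = 0"
    by (rule const[where h="\<lambda>s. sin (V s t)"]) (use cs in \<open>auto intro!: derivative_eq_intros V\<close>)
  moreover have "sin (V s0 t) \<noteq> 0 \<or> cos (V s0 t) \<noteq> 0"
    using sin_cos_squared_add[of "V s0 t"] by force
  ultimately show ?thesis by auto
qed

text \<open>The Euler--Lagrange expressions of the energy density \<open>f w\<close>, where \<open>f = sinh u + lam\<close>, \<open>w\<close> is
  the speed, \<open>c\<close> and \<open>s\<close> are \<open>cosh u\<close> and \<open>sinh u\<close>, and \<open>w1\<close> is the derivative of \<open>w\<close>.
  They are proportional to \<open>(v', - u')\<close> because the energy does not depend on the parametrization.\<close>

lemma euler_lagrange_identities:
  fixes c s f e w w1 u1 u2 v1 v2 :: real
  assumes w: "w \<noteq> 0" "w\<^sup>2 = e * (v1\<^sup>2 * c\<^sup>2 - u1\<^sup>2)" and e: "e * e = 1"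
    and w1: "w1 = e * (v1 * v2 * c\<^sup>2 + v1\<^sup>2 * c * s * u1 - u1 * u2) / w"
  defines "m \<equiv> c\<^sup>2 * v1 * (v1\<^sup>2 * c\<^sup>2 - u1\<^sup>2)
    - f * (c * (u1 * v2 - v1 * u2) + 2 * s * u1\<^sup>2 * v1 - c\<^sup>2 * s * v1 ^ 3)"
  shows "c * w + f * e * v1\<^sup>2 * c * s / w + e * ((c * u1 * u1 + f * u2) / w - f * u1 * w1 / w\<^sup>2)
      = c * v1 * m / w ^ 3"
    and "e * ((c * u1 * v1 * c\<^sup>2 + f * v2 * c\<^sup>2 + 2 * f * v1 * c * s * u1) / w - f * v1 * c\<^sup>2 * w1 / w\<^sup>2)
      = c * u1 * m / w ^ 3"
proof -
  \<comment> \<open>Over the common denominator \<open>w ^ 3\<close> only \<open>w\<^sup>2\<close>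
    and \<open>w1 * w\<close> remain, and both are polynomials, so the identities become algebraic
    modulo \<open>e * e = 1\<close>.\<close>
  have ww1: "w1 * w = e * (v1 * v2 * c\<^sup>2 + v1\<^sup>2 * c * s * u1 - u1 * u2)"
    using w1 w(1) by simp
  have "c * w + f * e * v1\<^sup>2 * c * s / w + e * ((c * u1 * u1 + f * u2) / w - f * u1 * w1 / w\<^sup>2)
    = (c * (w\<^sup>2)\<^sup>2 + f * e * v1\<^sup>2 * c * s * w\<^sup>2 + e * ((c * u1 * u1 + f * u2) * w\<^sup>2 - f * u1 * (w1 * w))) / w ^ 3"
    using w(1) by (simp add: field_simps power2_eq_square power3_eq_cube)
  also have "c * (w\<^sup>2)\<^sup>2 + f * e * v1\<^sup>2 * c * s * w\<^sup>2 + e * ((c * u1 * u1 + f * u2) * w\<^sup>2 - f * u1 * (w1 * w)) = c * v1 * m"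
    unfolding ww1 w(2) m_def using e by algebra
  finally show "c * w + f * e * v1\<^sup>2 * c * s / w + e * ((c * u1 * u1 + f * u2) / w - f * u1 * w1 / w\<^sup>2)
      = c * v1 * m / w ^ 3" .
  \<comment> \<open>The density does not involve \<open>v\<close> itself, so its Euler--Lagrange
    expression reduces, up to sign, to the derivative of the momentum of \<open>v\<close>.\<close>
  have "e * ((c * u1 * v1 * c\<^sup>2 + f * v2 * c\<^sup>2 + 2 * f * v1 * c * s * u1) / w - f * v1 * c\<^sup>2 * w1 / w\<^sup>2)
    = e * ((c * u1 * v1 * c\<^sup>2 + f * v2 * c\<^sup>2 + 2 * f * v1 * c * s * u1) * w\<^sup>2 - f * v1 * c\<^sup>2 * (w1 * w)) / w ^ 3"
    using w(1) by (simp add: field_simps power2_eq_square power3_eq_cube)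
  also have "e * ((c * u1 * v1 * c\<^sup>2 + f * v2 * c\<^sup>2 + 2 * f * v1 * c * s * u1) * w\<^sup>2 - f * v1 * c\<^sup>2 * (w1 * w)) = c * u1 * m"
    unfolding ww1 w(2) m_def using e by algebra
  finally show "e * ((c * u1 * v1 * c\<^sup>2 + f * v2 * c\<^sup>2 + 2 * f * v1 * c * s * u1) / w - f * v1 * c\<^sup>2 * w1 / w\<^sup>2)
      = c * u1 * m / w ^ 3" .
qed

section \<open>A fixed curve and its curvature equation\<close>

locale xy_curve =
  fixes lam a b :: real and u v :: "real \<Rightarrow> real"
  assumes less: "a < b"
    and smooth: "smooth_on {a..b} u" "smooth_on {a..b} v"
    and nondegenerate: "nondegenerate a b (param_curve u v)"
    and pos: "t \<in> {a..b} \<Longrightarrow> u t > 0"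
begin

definition "u1 = velocity a b u"
definition "v1 = velocity a b v"
definition "u2 = velocity a b u1"
definition "v2 = velocity a b v1"
definition "\<epsilon> = causal_sign a b (param_curve u v)"
definition "w t = sqrt (\<epsilon> * ((v1 t)\<^sup>2 * (cosh (u t))\<^sup>2 - (u1 t)\<^sup>2))"
text \<open>The Euler--Lagrange expressions of the energy are \<open>cosh u v' M / w\<^sup>3\<close> and \<open>- cosh u u' M / w\<^sup>3\<close>.\<close>

definition "M t = (cosh (u t))\<^sup>2 * v1 t * ((v1 t)\<^sup>2 * (cosh (u t))\<^sup>2 - (u1 t)\<^sup>2)
  - (sinh (u t) + lam) * (cosh (u t) * (u1 t * v2 t - v1 t * u2 t)
      + 2 * sinh (u t) * (u1 t)\<^sup>2 * v1 t - (cosh (u t))\<^sup>2 * sinh (u t) * v1 t ^ 3)"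

lemma smooth_derivs: "smooth_on {a..b} u1" "smooth_on {a..b} v1" "smooth_on {a..b} u2" "smooth_on {a..b} v2"
  unfolding u1_def v1_def u2_def v2_def by (intro smooth_on_velocity less smooth)+

lemma smooth_M: "smooth_on {a..b} M"
  unfolding M_def by (intro smooth_intros smooth smooth_derivs)

lemma derivs:
  assumes "t \<in> {a..b}"
  shows "(u has_real_derivative u1 t) (at t within {a..b})"
    and "(v has_real_derivative v1 t) (at t within {a..b})"
    and "(u1 has_real_derivative u2 t) (at t within {a..b})"
    and "(v1 has_real_derivative v2 t) (at t within {a..b})"
  using assms smooth smooth_derivs
  unfolding u1_def[symmetric] v1_def[symmetric]
  by (simp_all add: has_real_derivative_velocity u2_def v2_def)
    (simp_all add: has_real_derivative_velocity u1_def v1_def)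

lemma \<epsilon>_square: "\<epsilon> * \<epsilon> = 1"
  by (simp add: \<epsilon>_def causal_sign_def)

lemma \<epsilon>_q_pos: "t \<in> {a..b} \<Longrightarrow> \<epsilon> * ((v1 t)\<^sup>2 * (cosh (u t))\<^sup>2 - (u1 t)\<^sup>2) > 0"
  unfolding \<epsilon>_def by (rule causal_sign_param_curve(2)[OF less _ nondegenerate derivs(1,2)]) auto

lemma w_pos: "t \<in> {a..b} \<Longrightarrow> w t > 0"
  using \<epsilon>_q_pos by (simp add: w_def)

lemma w_square: "t \<in> {a..b} \<Longrightarrow> (w t)\<^sup>2 = \<epsilon> * ((v1 t)\<^sup>2 * (cosh (u t))\<^sup>2 - (u1 t)\<^sup>2)"
  using \<epsilon>_q_pos[of t] by (simp add: w_def)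

text \<open>The curvature is \<open>- \<epsilon> * D / w\<^sup>3\<close> and the normal pairs with
  \<open>Z\<close> to \<open>- cosh\<^sup>2 u * v' / w\<close>. Clearing the nonzero denominators
  and inserting the formula for \<open>w\<^sup>2\<close> leaves
  \<open>\<epsilon> * M t = 0\<close>.\<close>

lemma curvature_equation_iff:
  assumes t: "t \<in> {a..b}" and f: "sinh (u t) + lam \<noteq> 0"
  shows "curvature a b (param_curve u v) t =
      lorentz (principal_normal a b (param_curve u v) t) Z / (dist_xy (param_curve u v t) + lam)
    \<longleftrightarrow> M t = 0"
proof -
  let ?c = "cosh (u t)" and ?s = "sinh (u t)" and ?C = "cos (v t)" and ?S = "sin (v t)"
  \<comment> \<open>This is the bracket multiplied by \<open>sinh (u t) + lam\<close> in
    \<open>M\<close>.\<close>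
  define D where "D = ?c * (u1 t * v2 t - v1 t * u2 t) + 2 * ?s * (u1 t)\<^sup>2 * v1 t - ?c\<^sup>2 * ?s * v1 t ^ 3"
  note vel = velocity_param_curve[OF less t derivs(1,2)[OF t]]
  note acc = second_velocity_param_curve[OF less smooth t, folded u1_def v1_def, folded u2_def v2_def]
  have speed: "speed a b (param_curve u v) t = w t"
    by (simp add: speed_def lorentz_velocity_param_curve[OF less t derivs(1,2)[OF t]] w_def \<epsilon>_def)
  have trig: "?S\<^sup>2 + ?C\<^sup>2 = 1" "?c\<^sup>2 = ?s\<^sup>2 + 1"
    by (simp_all add: cosh_square_eq)
  have det: "lorentz (velocity a b (velocity a b (param_curve u v)) t)
      (lorentz_cross (velocity a b (param_curve u v) t) (xi (param_curve u v t))) = - D"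
    by (simp add: vel acc lorentz_def lorentz_cross_def xi_def param_curve_def Psi_def D_def)
      (use trig in algebra)
  have "lorentz (principal_normal a b (param_curve u v) t) Z
      = (?c * ?S * (?s * u1 t * ?C - ?c * ?S * v1 t) - ?c * ?C * (?s * u1 t * ?S + ?c * ?C * v1 t)) / w t"
    by (simp add: principal_normal_def speed vel lorentz_def lorentz_cross_def xi_def param_curve_def
        Psi_def Z_def minus_divide_left del: divide_minus_left)
  also have "?c * ?S * (?s * u1 t * ?C - ?c * ?S * v1 t) - ?c * ?C * (?s * u1 t * ?S + ?c * ?C * v1 t)
      = - (?c\<^sup>2 * v1 t)"
    using trig by algebra
  finally have normal: "lorentz (principal_normal a b (param_curve u v) t) Z = - (?c\<^sup>2 * v1 t) / w t" .
  have "curvature a b (param_curve u v) t =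
      lorentz (principal_normal a b (param_curve u v) t) Z / (dist_xy (param_curve u v t) + lam)
    \<longleftrightarrow> \<epsilon> * - D / w t ^ 3 = - (?c\<^sup>2 * v1 t) / w t / (?s + lam)"
    unfolding curvature_def det speed normal dist_xy_param_curve \<epsilon>_def by simp
  also have "\<dots> \<longleftrightarrow> \<epsilon> * D * (?s + lam) = ?c\<^sup>2 * v1 t * (w t)\<^sup>2"
  proof -
    have "e * - d / r ^ 3 = - k / r / g \<longleftrightarrow> e * d * g = k * r\<^sup>2"
      if "r > 0" "g \<noteq> 0" for e d k r g :: real
      using that by (simp add: field_simps power2_eq_square power3_eq_cube)
    then show ?thesis using w_pos[OF t] f by blast
  qed
  also have "\<dots> \<longleftrightarrow> \<epsilon> * M t = 0"
    unfolding w_square[OF t] M_def D_def by (auto simp: algebra_simps)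
  also have "\<dots> \<longleftrightarrow> M t = 0"
    using \<epsilon>_square by auto
  finally show ?thesis .
qed

section \<open>First variation formula\<close>

lemma w_deriv:
  assumes t: "t \<in> {a..b}"
  shows "(w has_real_derivative
    \<epsilon> * (v1 t * v2 t * (cosh (u t))\<^sup>2 + (v1 t)\<^sup>2 * cosh (u t) * sinh (u t) * u1 t - u1 t * u2 t) / w t)
    (at t within {a..b})"
proof -
  \<comment> \<open>The factor 1/2 from the square root cancels the 2 common to all terms of the
    derivative of the radicand.\<close>
  have half: "inverse r / 2 * (2 * n) = n / r" for r n :: real
    by (simp add: inverse_eq_divide)
  let ?q = "\<lambda>t. \<epsilon> * ((v1 t)\<^sup>2 * (cosh (u t))\<^sup>2 - (u1 t)\<^sup>2)"
  let ?n = "\<epsilon> * (v1 t * v2 t * (cosh (u t))\<^sup>2 + (v1 t)\<^sup>2 * cosh (u t) * sinh (u t) * u1 t - u1 t * u2 t)"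
  have "(?q has_real_derivative 2 * ?n) (at t within {a..b})"
    by (auto intro!: derivative_eq_intros derivs[OF t] simp: algebra_simps power2_eq_square)
  from DERIV_chain2[OF DERIV_real_sqrt[OF \<epsilon>_q_pos[OF t]] this]
  show ?thesis
    unfolding w_def by (rule DERIV_cong) (rule half)
qed

text \<open>The derivative of \<open>P t * \<eta> t + Q t * \<zeta> t\<close> integrates to zero
  because the fields vanish at both ends. Subtracting it from the integrand removes
  \<open>\<eta>'\<close> and \<open>\<zeta>'\<close>.\<close>

lemma integration_by_parts:
  assumes \<eta>: "\<And>t. t \<in> {a..b} \<Longrightarrow> (\<eta> has_real_derivative \<eta>' t) (at t within {a..b})"
    and \<zeta>: "\<And>t. t \<in> {a..b} \<Longrightarrow> (\<zeta> has_real_derivative \<zeta>' t) (at t within {a..b})"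
    and ends: "\<eta> a = 0" "\<eta> b = 0" "\<zeta> a = 0" "\<zeta> b = 0"
    and int: "(\<lambda>t. cosh (u t) * \<eta> t * w t
      + (sinh (u t) + lam) * \<epsilon> * ((v1 t)\<^sup>2 * cosh (u t) * sinh (u t) * \<eta> t
        + v1 t * \<zeta>' t * (cosh (u t))\<^sup>2 - u1 t * \<eta>' t) / w t) integrable_on {a..b}" (is "?L integrable_on _")
  shows "integral {a..b} ?L = integral {a..b} (\<lambda>t. cosh (u t) * M t / w t ^ 3 * (v1 t * \<eta> t - u1 t * \<zeta> t))"
proof -
  define w1 where "w1 t = \<epsilon> * (v1 t * v2 t * (cosh (u t))\<^sup>2
    + (v1 t)\<^sup>2 * cosh (u t) * sinh (u t) * u1 t - u1 t * u2 t) / w t" for t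
  \<comment> \<open>\<open>P\<close> and \<open>Q\<close> are the momenta \<open>\<partial>L/\<partial>u'\<close> and \<open>\<partial>L/\<partial>v'\<close>.\<close>
  define P where "P t = - (\<epsilon> * ((sinh (u t) + lam) * u1 t / w t))" for t
  define Q where "Q t = \<epsilon> * ((sinh (u t) + lam) * v1 t * (cosh (u t))\<^sup>2 / w t)" for t
  define P' where "P' t = - (\<epsilon> * ((cosh (u t) * u1 t * u1 t + (sinh (u t) + lam) * u2 t) / w t
    - (sinh (u t) + lam) * u1 t * w1 t / (w t)\<^sup>2))" for t
  define Q' where "Q' t = \<epsilon> * ((cosh (u t) * u1 t * v1 t * (cosh (u t))\<^sup>2 + (sinh (u t) + lam) * v2 t * (cosh (u t))\<^sup>2
      + 2 * (sinh (u t) + lam) * v1 t * cosh (u t) * sinh (u t) * u1 t) / w t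
    - (sinh (u t) + lam) * v1 t * (cosh (u t))\<^sup>2 * w1 t / (w t)\<^sup>2)" for t
  have P: "(P has_real_derivative P' t) (at t within {a..b})"
    and Q: "(Q has_real_derivative Q' t) (at t within {a..b})" if t: "t \<in> {a..b}" for t
  proof -
    note d = derivs[OF t] w_deriv[OF t, folded w1_def]
    have f: "((\<lambda>t. sinh (u t) + lam) has_real_derivative cosh (u t) * u1 t) (at t within {a..b})"
      by (auto intro!: derivative_eq_intros d)
    have c: "((\<lambda>t. (cosh (u t))\<^sup>2) has_real_derivative 2 * cosh (u t) * sinh (u t) * u1 t) (at t within {a..b})"
      by (auto intro!: derivative_eq_intros d)
    have w: "w t \<noteq> 0" using w_pos[OF t] by simp
    show "(P has_real_derivative P' t) (at t within {a..b})"
      unfolding P_def P'_def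
      by (rule DERIV_cong[OF DERIV_minus[OF DERIV_cmult[OF DERIV_divide[OF DERIV_mult[OF f d(3)] d(5) w]]]])
        (simp add: w diff_divide_distrib add_divide_distrib power2_eq_square algebra_simps)
    show "(Q has_real_derivative Q' t) (at t within {a..b})"
      unfolding Q_def Q'_def
      by (rule DERIV_cong[OF DERIV_cmult[OF DERIV_divide[OF DERIV_mult[OF DERIV_mult[OF f d(4)] c] d(5) w]]])
        (simp add: w diff_divide_distrib add_divide_distrib power2_eq_square algebra_simps)
  qed
  have "((\<lambda>t. (P' t * \<eta> t + \<eta>' t * P t) + (Q' t * \<zeta> t + \<zeta>' t * Q t)) has_integral
      (P b * \<eta> b + Q b * \<zeta> b) - (P a * \<eta> a + Q a * \<zeta> a)) {a..b}"
  proof (rule fundamental_theorem_of_calculus)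
    fix t assume t: "t \<in> {a..b}"
    show "((\<lambda>t. P t * \<eta> t + Q t * \<zeta> t) has_vector_derivative
        (P' t * \<eta> t + \<eta>' t * P t) + (Q' t * \<zeta> t + \<zeta>' t * Q t)) (at t within {a..b})"
      unfolding has_real_derivative_iff_has_vector_derivative[symmetric]
      by (intro DERIV_add DERIV_mult P Q \<eta> \<zeta> t)
  qed (use less in simp)
  then have parts: "((\<lambda>t. (P' t * \<eta> t + \<eta>' t * P t) + (Q' t * \<zeta> t + \<zeta>' t * Q t)) has_integral 0) {a..b}"
    by (simp add: ends)
  \<comment> \<open>The coefficients of \<open>\<eta>'\<close> and \<open>\<zeta>'\<close> in
    \<open>?L\<close> are exactly the momenta and cancel. What remains are the two Euler--Lagrange
    expressions, both multiples of \<open>M t\<close>.\<close>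
  have "?L t - ((P' t * \<eta> t + \<eta>' t * P t) + (Q' t * \<zeta> t + \<zeta>' t * Q t))
      = cosh (u t) * M t / w t ^ 3 * (v1 t * \<eta> t - u1 t * \<zeta> t)" if t: "t \<in> {a..b}" for t
  proof -
    have w: "w t \<noteq> 0" using w_pos[OF t] by simp
    note EL = euler_lagrange_identities[OF w w_square[OF t] \<epsilon>_square w1_def[of t],
        where f="sinh (u t) + lam", folded M_def]
    have "?L t - ((P' t * \<eta> t + \<eta>' t * P t) + (Q' t * \<zeta> t + \<zeta>' t * Q t))
      = (cosh (u t) * w t + (sinh (u t) + lam) * \<epsilon> * (v1 t)\<^sup>2 * cosh (u t) * sinh (u t) / w t - P' t) * \<eta> t
        - Q' t * \<zeta> t"
      unfolding P_def Q_def by (simp add: add_divide_distrib diff_divide_distrib algebra_simps)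
    also have "\<dots> = cosh (u t) * v1 t * M t / w t ^ 3 * \<eta> t - cosh (u t) * u1 t * M t / w t ^ 3 * \<zeta> t"
      unfolding EL(1)[symmetric] EL(2)[symmetric] P'_def Q'_def by simp
    finally show ?thesis by (simp add: add_divide_distrib diff_divide_distrib algebra_simps)
  qed
  moreover have "((\<lambda>t. ?L t - ((P' t * \<eta> t + \<eta>' t * P t) + (Q' t * \<zeta> t + \<zeta>' t * Q t)))
      has_integral (integral {a..b} ?L - 0)) {a..b}"
    by (intro has_integral_diff integrable_integral int parts)
  ultimately have "((\<lambda>t. cosh (u t) * M t / w t ^ 3 * (v1 t * \<eta> t - u1 t * \<zeta> t))
      has_integral (integral {a..b} ?L - 0)) {a..b}"
    by (rule has_integral_eq)
  then show ?thesis by (simp add: integral_unique)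
qed

text \<open>The energy is differentiated under the integral and then integrated by parts. The fields
  are returned with their defining property, so that for a concrete variation they can be identified
  by uniqueness of derivatives.\<close>

lemma first_variation:
  assumes "admissible_variation a b u v \<delta> U V"
  obtains \<eta> \<zeta> where
    "\<And>t. t \<in> {a..b} \<Longrightarrow> ((\<lambda>s. U s t) has_real_derivative \<eta> t) (at 0)"
    "\<And>t. t \<in> {a..b} \<Longrightarrow> ((\<lambda>s. V s t) has_real_derivative \<zeta> t) (at 0)"
    "((\<lambda>s. energy_xy lam a b (U s) (V s)) has_real_derivative
       integral {a..b} (\<lambda>t. cosh (u t) * M t / w t ^ 3 * (v1 t * \<eta> t - u1 t * \<zeta> t))) (at 0)"
proof -
  let ?I = "{-\<delta><..<\<delta>}" and ?J = "{a..b}"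
  from assms have \<delta>: "\<delta> > 0"
    and sU: "smooth_on (?I \<times> ?J) (\<lambda>(s, t). U s t)" and sV: "smooth_on (?I \<times> ?J) (\<lambda>(s, t). V s t)"
    and start: "\<And>t. t \<in> ?J \<Longrightarrow> U 0 t = u t" "\<And>t. t \<in> ?J \<Longrightarrow> V 0 t = v t"
    and nd: "\<And>s. s \<in> ?I \<Longrightarrow> nondegenerate a b (param_curve (U s) (V s))"
    and ends: "\<And>s. s \<in> ?I \<Longrightarrow> param_curve (U s) (V s) a = param_curve u v a"
      "\<And>s. s \<in> ?I \<Longrightarrow> param_curve (U s) (V s) b = param_curve u v b"
    unfolding admissible_variation_def by auto
  have zero: "0 \<in> ?I" using \<delta> by simp
  have aJ: "a \<in> ?J" and bJ: "b \<in> ?J" using less by auto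
  obtain Us Ut Ust where
    Us: "\<And>s t. s \<in> ?I \<Longrightarrow> t \<in> ?J \<Longrightarrow> ((\<lambda>s. U s t) has_real_derivative Us s t) (at s)"
    and Ut: "\<And>s t. s \<in> ?I \<Longrightarrow> t \<in> ?J \<Longrightarrow> (U s has_real_derivative Ut s t) (at t within ?J)"
    and Uts: "\<And>s t. s \<in> ?I \<Longrightarrow> t \<in> ?J \<Longrightarrow> ((\<lambda>s. Ut s t) has_real_derivative Ust s t) (at s)"
    and Ust: "\<And>s t. s \<in> ?I \<Longrightarrow> t \<in> ?J \<Longrightarrow> (Us s has_real_derivative Ust s t) (at t within ?J)"
    and cU: "continuous_on (?I \<times> ?J) (\<lambda>(s, t). U s t)" "continuous_on (?I \<times> ?J) (\<lambda>(s, t). Us s t)"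
      "continuous_on (?I \<times> ?J) (\<lambda>(s, t). Ut s t)" "continuous_on (?I \<times> ?J) (\<lambda>(s, t). Ust s t)"
    by (rule smooth_on_strip_partials[OF sU]) (rule that)
  obtain Vs Vt Vst where
    Vs: "\<And>s t. s \<in> ?I \<Longrightarrow> t \<in> ?J \<Longrightarrow> ((\<lambda>s. V s t) has_real_derivative Vs s t) (at s)"
    and Vt: "\<And>s t. s \<in> ?I \<Longrightarrow> t \<in> ?J \<Longrightarrow> (V s has_real_derivative Vt s t) (at t within ?J)"
    and Vts: "\<And>s t. s \<in> ?I \<Longrightarrow> t \<in> ?J \<Longrightarrow> ((\<lambda>s. Vt s t) has_real_derivative Vst s t) (at s)"
    and Vst: "\<And>s t. s \<in> ?I \<Longrightarrow> t \<in> ?J \<Longrightarrow> (Vs s has_real_derivative Vst s t) (at t within ?J)"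
    and cV: "continuous_on (?I \<times> ?J) (\<lambda>(s, t). V s t)" "continuous_on (?I \<times> ?J) (\<lambda>(s, t). Vs s t)"
      "continuous_on (?I \<times> ?J) (\<lambda>(s, t). Vt s t)" "continuous_on (?I \<times> ?J) (\<lambda>(s, t). Vst s t)"
    by (rule smooth_on_strip_partials[OF sV]) (rule that)
  note cont = cU[unfolded case_prod_beta'] cV[unfolded case_prod_beta']

  have velU: "velocity a b (U s) t = Ut s t" and velV: "velocity a b (V s) t = Vt s t"
    if "s \<in> ?I" "t \<in> ?J" for s t
    using that Ut[OF that] Vt[OF that]
    by (auto intro!: velocity_eqI less simp flip: has_real_derivative_iff_has_vector_derivative)
  have u: "(u has_real_derivative Ut 0 t) (at t within ?J)"
    and v: "(v has_real_derivative Vt 0 t) (at t within ?J)" if "t \<in> ?J" for t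
    using has_derivative_transform[OF that start(1)[symmetric] Ut[OF zero that, unfolded has_field_derivative_def]]
      has_derivative_transform[OF that start(2)[symmetric] Vt[OF zero that, unfolded has_field_derivative_def]]
    by (simp_all add: has_field_derivative_def)
  have ut: "Ut 0 t = u1 t" and vt: "Vt 0 t = v1 t" if "t \<in> ?J" for t
    using velocity_eqI[OF less that, of u "Ut 0 t"] velocity_eqI[OF less that, of v "Vt 0 t"] u[OF that] v[OF that]
    by (simp_all add: u1_def v1_def has_real_derivative_iff_has_vector_derivative)

  \<comment> \<open>The energy of each curve in the family uses that curve's own causal sign. The
    quadratic form of the velocity at \<open>a\<close> is continuous in \<open>s\<close> and never
    zero, so the sign stays \<open>\<epsilon>\<close>, and one formula for the density holds for all
    \<open>s\<close>.\<close>
  have q_pos: "\<epsilon> * ((Vt s t)\<^sup>2 * (cosh (U s t))\<^sup>2 - (Ut s t)\<^sup>2) > 0"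
    and sign: "causal_sign a b (param_curve (U s) (V s)) = \<epsilon>" if s: "s \<in> ?I" and "t \<in> ?J" for s t
  proof -
    let ?g = "\<lambda>s. (Vt s a)\<^sup>2 * (cosh (U s a))\<^sup>2 - (Ut s a)\<^sup>2"
    have cs1: "causal_sign a b (param_curve (U s) (V s)) = sgn (?g s)" if "s \<in> ?I" for s
      by (rule causal_sign_param_curve(1)[OF less aJ nd[OF that] Ut[OF that] Vt[OF that]])
    have cs2: "causal_sign a b (param_curve (U s) (V s)) * ((Vt s t)\<^sup>2 * (cosh (U s t))\<^sup>2 - (Ut s t)\<^sup>2) > 0"
      if "s \<in> ?I" "t \<in> ?J" for s t
      by (rule causal_sign_param_curve(2)[OF less aJ nd[OF that(1)] Ut[OF that(1)] Vt[OF that(1)] that(2)])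
    have "continuous_on ?I (\<lambda>s. f s a)" if "continuous_on (?I \<times> ?J) (\<lambda>(s, t). f s t)"
      for f :: "real \<Rightarrow> real \<Rightarrow> real"
    proof -
      have "continuous_on ?I (\<lambda>s. (\<lambda>(s, t). f s t) (s, a))"
        by (rule continuous_on_compose2[OF that]) (use aJ in \<open>auto intro!: continuous_intros\<close>)
      then show ?thesis by simp
    qed
    from this[OF cU(1)] this[OF cU(3)] this[OF cV(3)] have "continuous_on ?I ?g"
      by (intro continuous_intros)
    moreover have "?g s \<noteq> 0" if "s \<in> ?I" for s
      using cs2[OF that aJ] by force
    ultimately have "sgn (?g s) = sgn (?g 0)"
      by (intro sgn_eq_of_connected[OF connected_Ioo _ _ s zero])
    moreover have "\<epsilon> = sgn (?g 0)"
      unfolding \<epsilon>_def using causal_sign_param_curve(1)[OF less aJ nondegenerate u v] start(1)[OF aJ] by simp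
    ultimately show sign: "causal_sign a b (param_curve (U s) (V s)) = \<epsilon>"
      using cs1[OF s] by (simp only:)
    show "\<epsilon> * ((Vt s t)\<^sup>2 * (cosh (U s t))\<^sup>2 - (Ut s t)\<^sup>2) > 0"
      using cs2[OF s \<open>t \<in> ?J\<close>] by (simp only: sign)
  qed

  \<comment> \<open>\<open>W\<close> is the speed of the varied curve, \<open>L\<close> the energy
    density and \<open>Ls\<close> its derivative in \<open>s\<close>.\<close>
  define W where "W s t = sqrt (\<epsilon> * ((Vt s t)\<^sup>2 * (cosh (U s t))\<^sup>2 - (Ut s t)\<^sup>2))" for s t
  define L where "L s t = (sinh (U s t) + lam) * W s t" for s t
  define Ls where "Ls s t = cosh (U s t) * Us s t * W s t
    + (sinh (U s t) + lam) * \<epsilon> * ((Vt s t)\<^sup>2 * cosh (U s t) * sinh (U s t) * Us s t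
        + Vt s t * Vst s t * (cosh (U s t))\<^sup>2 - Ut s t * Ust s t) / W s t" for s t
  have W: "W s t > 0" if "s \<in> ?I" "t \<in> ?J" for s t
    unfolding W_def by (rule real_sqrt_gt_zero[OF q_pos[OF that]])
  have cW: "continuous_on (?I \<times> ?J) (\<lambda>x. W (fst x) (snd x))"
    unfolding W_def by (intro continuous_intros cont)
  have cL: "continuous_on (?I \<times> ?J) (\<lambda>(s, t). L s t)"
    unfolding case_prod_beta' L_def by (intro continuous_intros cont cW)
  have cLs: "continuous_on (?I \<times> ?J) (\<lambda>(s, t). Ls s t)"
    unfolding case_prod_beta' Ls_def by (intro continuous_intros cont cW) (use W in force)
  have dL: "((\<lambda>s. L s t) has_real_derivative Ls s t) (at s within ?I)" if "s \<in> ?I" "t \<in> ?J" for s t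
  proof -
    have half: "inverse r / 2 * (2 * n) = n / r" for r n :: real
      by (simp add: inverse_eq_divide)
    let ?q = "\<lambda>s. \<epsilon> * ((Vt s t)\<^sup>2 * (cosh (U s t))\<^sup>2 - (Ut s t)\<^sup>2)"
    let ?n = "\<epsilon> * ((Vt s t)\<^sup>2 * cosh (U s t) * sinh (U s t) * Us s t
        + Vt s t * Vst s t * (cosh (U s t))\<^sup>2 - Ut s t * Ust s t)"
    note d = Us[OF that] Uts[OF that] Vts[OF that]
    have "(?q has_real_derivative 2 * ?n) (at s)"
      by (auto intro!: derivative_eq_intros d simp: algebra_simps power2_eq_square)
    from DERIV_chain2[OF DERIV_real_sqrt[OF q_pos[OF that]] this]
    have "((\<lambda>s. W s t) has_real_derivative ?n / W s t) (at s)"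
      unfolding W_def by (rule DERIV_cong) (rule half)
    then have "((\<lambda>s. L s t) has_real_derivative Ls s t) (at s)"
      unfolding L_def Ls_def by (auto intro!: derivative_eq_intros d)
    then show ?thesis by (rule has_field_derivative_at_within)
  qed
  have "((\<lambda>s. integral (cbox a b) (L s)) has_real_derivative integral (cbox a b) (Ls 0)) (at 0 within ?I)"
  proof (rule leibniz_rule_field_derivative[OF dL])
    show "L s integrable_on cbox a b" if "s \<in> ?I" for s
      using continuous_on_slice[OF cL that] by (simp add: integrable_continuous_real)
    show "continuous_on (?I \<times> cbox a b) (\<lambda>(s, t). Ls s t)" using cLs by simp
  qed (use zero in auto)
  then have "((\<lambda>s. integral ?J (L s)) has_real_derivative integral ?J (Ls 0)) (at 0)"
    by (simp only: at_within_open[OF zero open_greaterThanLessThan] box_real)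
  moreover have "integral ?J (L s) = energy_xy lam a b (U s) (V s)" if "s \<in> ?I" for s
    unfolding energy_xy_def
    by (rule integral_cong) (simp add: L_def W_def sign[OF that aJ] velU[OF that] velV[OF that])
  ultimately have "((\<lambda>s. energy_xy lam a b (U s) (V s)) has_real_derivative integral ?J (Ls 0)) (at 0)"
    by (rule has_field_derivative_transform_within_open[OF _ open_greaterThanLessThan zero])
  also have "integral ?J (Ls 0) = integral ?J (\<lambda>t. cosh (u t) * Us 0 t * w t
      + (sinh (u t) + lam) * \<epsilon> * ((v1 t)\<^sup>2 * cosh (u t) * sinh (u t) * Us 0 t
        + v1 t * Vst 0 t * (cosh (u t))\<^sup>2 - u1 t * Ust 0 t) / w t)" (is "_ = integral ?J ?F")
    by (rule integral_cong) (simp add: Ls_def W_def w_def ut vt start)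
  also have "\<dots> = integral ?J (\<lambda>t. cosh (u t) * M t / w t ^ 3 * (v1 t * Us 0 t - u1 t * Vs 0 t))"
  proof (rule integration_by_parts)
    show "(Us 0 has_real_derivative Ust 0 t) (at t within ?J)"
      and "(Vs 0 has_real_derivative Vst 0 t) (at t within ?J)" if "t \<in> ?J" for t
      using Ust Vst zero that by auto
    show "Us 0 a = 0" "Us 0 b = 0" "Vs 0 a = 0" "Vs 0 b = 0"
      using param_curve_fixed_imp_derivative_zero[OF open_greaterThanLessThan zero ends(1) Us[OF zero aJ] Vs[OF zero aJ]]
        param_curve_fixed_imp_derivative_zero[OF open_greaterThanLessThan zero ends(2) Us[OF zero bJ] Vs[OF zero bJ]]
      by auto
    have "Ls 0 integrable_on ?J"
      using continuous_on_slice[OF cLs zero] by (rule integrable_continuous_real)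
    then show "?F integrable_on ?J"
      by (rule integrable_eq) (simp add: Ls_def W_def w_def ut vt start)
  qed
  finally have deriv: "((\<lambda>s. energy_xy lam a b (U s) (V s)) has_real_derivative
      integral ?J (\<lambda>t. cosh (u t) * M t / w t ^ 3 * (v1 t * Us 0 t - u1 t * Vs 0 t))) (at 0)" .
  show ?thesis
    by (rule that[OF Us[OF zero] Vs[OF zero] deriv])
qed

section \<open>Critical points and zeros of \<open>M\<close>\<close>

lemma catenary_iff: "catenary_xy lam a b u v \<longleftrightarrow> (\<forall>t\<in>{a..b}. M t = 0)"
proof
  assume M: "\<forall>t\<in>{a..b}. M t = 0"
  show "catenary_xy lam a b u v"
    unfolding catenary_xy_def
  proof (intro allI impI)
    fix \<delta> U V assume "admissible_variation a b u v \<delta> U V"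
    then obtain \<eta> \<zeta> where "((\<lambda>s. energy_xy lam a b (U s) (V s)) has_real_derivative
       integral {a..b} (\<lambda>t. cosh (u t) * M t / w t ^ 3 * (v1 t * \<eta> t - u1 t * \<zeta> t))) (at 0)"
      by (rule first_variation)
    moreover have "integral {a..b} (\<lambda>t. cosh (u t) * M t / w t ^ 3 * (v1 t * \<eta> t - u1 t * \<zeta> t))
        = integral {a..b} (\<lambda>t. 0)"
      by (rule integral_cong) (simp add: M)
    ultimately show "((\<lambda>s. energy_xy lam a b (U s) (V s)) has_real_derivative 0) (at 0)" by simp
  qed
next
  assume cat: "catenary_xy lam a b u v"
  \<comment> \<open>The factor \<open>(t - a) * (b - t)\<close> keeps the end points fixed and is
    positive between them.\<close>
  define \<phi> where "\<phi> t = (t - a) * (b - t) * M t" for t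
  define \<eta> where "\<eta> t = \<phi> t * v1 t" for t
  define \<zeta> where "\<zeta> t = - 1 * (\<phi> t * u1 t)" for t
  define U where "U s t = u t + s * \<eta> t" for s t
  define V where "V s t = v t + s * \<zeta> t" for s t
  have \<phi>: "smooth_on {a..b} \<phi>"
    unfolding \<phi>_def by (intro smooth_intros smooth_M)
  have \<eta>: "smooth_on {a..b} \<eta>" and \<zeta>: "smooth_on {a..b} \<zeta>"
    unfolding \<eta>_def \<zeta>_def by (intro smooth_intros \<phi> smooth_derivs)+
  define \<eta>' where "\<eta>' = velocity a b \<eta>"
  define \<zeta>' where "\<zeta>' = velocity a b \<zeta>"
  have smooth': "smooth_on {a..b} \<eta>'" "smooth_on {a..b} \<zeta>'"
    unfolding \<eta>'_def \<zeta>'_def by (intro smooth_on_velocity less \<eta> \<zeta>)+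
  have dU: "(U s has_real_derivative u1 t + s * \<eta>' t) (at t within {a..b})"
    and dV: "(V s has_real_derivative v1 t + s * \<zeta>' t) (at t within {a..b})" if t: "t \<in> {a..b}" for s t
    unfolding U_def V_def \<eta>'_def \<zeta>'_def
    by (auto intro!: derivative_eq_intros derivs[OF t] has_real_derivative_velocity[OF \<eta> t]
        has_real_derivative_velocity[OF \<zeta> t])
  \<comment> \<open>\<open>?Q\<close> is \<open>\<epsilon>\<close> times the quadratic form of the
    varied velocity and \<open>?R\<close> is the varied \<open>u\<close>. Both are positive at
    \<open>s = 0\<close>, so for small \<open>s\<close> the causal character and the condition
    \<open>z > 0\<close> persist.\<close>
  let ?Q = "\<lambda>x. \<epsilon> * ((v1 (snd x) + fst x * \<zeta>' (snd x))\<^sup>2 * (cosh (u (snd x) + fst x * \<eta> (snd x)))\<^sup>2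
    - (u1 (snd x) + fst x * \<eta>' (snd x))\<^sup>2)"
  let ?R = "\<lambda>x. u (snd x) + fst x * \<eta> (snd x)"
  have "continuous_on (UNIV \<times> {a..b}) ?Q"
    by (intro smooth_on_imp_continuous_on smooth_intros smooth smooth_derivs smooth' \<eta> \<zeta>)
  then obtain \<delta>1 where \<delta>1: "\<delta>1 > 0" "\<And>s t. s \<in> {-\<delta>1<..<\<delta>1} \<Longrightarrow> t \<in> {a..b} \<Longrightarrow> ?Q (s, t) > 0"
    by (rule positive_near_slice) (use \<epsilon>_q_pos in auto)
  have "continuous_on (UNIV \<times> {a..b}) ?R"
    by (intro smooth_on_imp_continuous_on smooth_intros smooth \<eta>)
  then obtain \<delta>2 where \<delta>2: "\<delta>2 > 0" "\<And>s t. s \<in> {-\<delta>2<..<\<delta>2} \<Longrightarrow> t \<in> {a..b} \<Longrightarrow> ?R (s, t) > 0"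
    by (rule positive_near_slice) (use pos in auto)
  define \<delta> where "\<delta> = min \<delta>1 \<delta>2"
  have adm: "admissible_variation a b u v \<delta> U V"
    unfolding admissible_variation_def
  proof (intro conjI ballI)
    show "\<delta> > 0" using \<delta>1(1) \<delta>2(1) by (simp add: \<delta>_def)
    show "smooth_on ({-\<delta><..<\<delta>} \<times> {a..b}) (\<lambda>(s, t). U s t)"
      "smooth_on ({-\<delta><..<\<delta>} \<times> {a..b}) (\<lambda>(s, t). V s t)"
      unfolding U_def V_def case_prod_beta' by (intro smooth_intros smooth \<eta> \<zeta>)+
    show "U 0 t = u t" "V 0 t = v t" for t by (simp_all add: U_def V_def)
    fix s assume "s \<in> {-\<delta><..<\<delta>}"
    then have s: "s \<in> {-\<delta>1<..<\<delta>1}" "s \<in> {-\<delta>2<..<\<delta>2}" by (auto simp: \<delta>_def)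
    have "\<epsilon> * lorentz (velocity a b (param_curve (U s) (V s)) t) (velocity a b (param_curve (U s) (V s)) t) > 0"
      if t: "t \<in> {a..b}" for t
      using \<delta>1(2)[OF s(1) t]
      by (simp only: lorentz_velocity_param_curve[OF less t dU[OF t] dV[OF t]] U_def fst_conv snd_conv)
    moreover have "\<epsilon> = 1 \<or> \<epsilon> = - 1" by (simp add: \<epsilon>_def causal_sign_def)
    ultimately show "nondegenerate a b (param_curve (U s) (V s))"
      unfolding nondegenerate_def spacelike_def timelike_def by auto
    show "param_curve (U s) (V s) t \<in> de_sitter_xy_pos" if "t \<in> {a..b}" for t
      using \<delta>2(2)[OF s(2) that] by (simp add: param_curve_mem_iff U_def)
    show "param_curve (U s) (V s) a = param_curve u v a" "param_curve (U s) (V s) b = param_curve u v b"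
      by (simp_all add: param_curve_def U_def V_def \<eta>_def \<zeta>_def \<phi>_def)
  qed
  then obtain \<eta>1 \<zeta>1 where
    var: "\<And>t. t \<in> {a..b} \<Longrightarrow> ((\<lambda>s. U s t) has_real_derivative \<eta>1 t) (at 0)"
      "\<And>t. t \<in> {a..b} \<Longrightarrow> ((\<lambda>s. V s t) has_real_derivative \<zeta>1 t) (at 0)"
    and energy: "((\<lambda>s. energy_xy lam a b (U s) (V s)) has_real_derivative
       integral {a..b} (\<lambda>t. cosh (u t) * M t / w t ^ 3 * (v1 t * \<eta>1 t - u1 t * \<zeta>1 t))) (at 0)"
    by (rule first_variation) (rule that)
  have "((\<lambda>s. U s t) has_real_derivative \<eta> t) (at 0)" "((\<lambda>s. V s t) has_real_derivative \<zeta> t) (at 0)" for t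
    unfolding U_def V_def by (auto intro!: derivative_eq_intros)
  then have field: "\<eta>1 t = \<eta> t" "\<zeta>1 t = \<zeta> t" if "t \<in> {a..b}" for t
    using var[OF that] DERIV_unique by blast+
  \<comment> \<open>With the chosen fields \<open>v1 t * \<eta> t - u1 t * \<zeta> t\<close> equals
    \<open>\<phi> t * ((u1 t)\<^sup>2 + (v1 t)\<^sup>2)\<close>, and the factor \<open>M t\<close>
    in \<open>\<phi> t\<close> completes a square.\<close>
  let ?G = "\<lambda>t. cosh (u t) * ((t - a) * (b - t)) * (M t)\<^sup>2 * ((u1 t)\<^sup>2 + (v1 t)\<^sup>2) / w t ^ 3"
  have "0 = integral {a..b} (\<lambda>t. cosh (u t) * M t / w t ^ 3 * (v1 t * \<eta>1 t - u1 t * \<zeta>1 t))"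
    using cat adm energy DERIV_unique unfolding catenary_xy_def by blast
  also have "\<dots> = integral {a..b} ?G"
    by (rule integral_cong) (simp add: field \<eta>_def \<zeta>_def \<phi>_def power2_eq_square algebra_simps
        add_divide_distrib diff_divide_distrib)
  finally have "integral {a..b} ?G = 0" by simp
  moreover have "continuous_on {a..b} ?G"
    by (intro continuous_intros smooth_derivs(1,2)[THEN smooth_on_imp_continuous_on]
        smooth(1)[THEN smooth_on_imp_continuous_on] smooth_M[THEN smooth_on_imp_continuous_on]
        DERIV_continuous_on[OF w_deriv]) (use w_pos in force)+
  moreover have "?G t \<ge> 0" if "t \<in> {a..b}" for t
    using that w_pos[OF that] by simp
  ultimately have G0: "?G t = 0" if "t \<in> {a..b}" for t
    using integral_eq_0_iff[OF _ less, of ?G] that by blast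
  \<comment> \<open>The polynomial factor is nonzero only inside the interval, and non-degeneracy
    excludes \<open>u1 t = v1 t = 0\<close>. The end points follow by continuity of
    \<open>M\<close>.\<close>
  have inner: "M t = 0" if "t \<in> {a<..<b}" for t
  proof -
    have t: "t \<in> {a..b}" using that by auto
    have "(u1 t)\<^sup>2 + (v1 t)\<^sup>2 \<noteq> 0"
      using \<epsilon>_q_pos[OF t] by (auto simp: sum_power2_eq_zero_iff)
    then show ?thesis using G0[OF t] w_pos[OF t] that by auto
  qed
  have "closure {a<..<b} = {a..b}" using less by simp
  then show "\<forall>t\<in>{a..b}. M t = 0"
    using continuous_constant_on_closure[of "{a<..<b}" M 0] inner smooth_on_imp_continuous_on[OF smooth_M]
    by auto
qed

end

theorem theorem2p4:
  fixes lam a b :: real and u v :: "real \<Rightarrow> real" and \<gamma> :: "real \<Rightarrow> real^3"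
  assumes "a < b"
    and "smooth_on {a..b} u" and "smooth_on {a..b} v"
    and "\<gamma> = param_curve u v"
    and "nondegenerate a b \<gamma>"
    and "\<forall>t\<in>{a..b}. \<gamma> t \<in> de_sitter_xy_pos"
    and "\<forall>t\<in>{a..b}. dist_xy (\<gamma> t) + lam \<noteq> 0"
  shows "catenary_xy lam a b u v \<longleftrightarrow>
    (\<forall>t\<in>{a..b}. curvature a b \<gamma> t = lorentz (principal_normal a b \<gamma> t) Z / (dist_xy (\<gamma> t) + lam))"
proof -
  interpret xy_curve lam a b u v
    using assms by unfold_locales (auto simp: param_curve_mem_iff)
  show ?thesis
    using assms(7) curvature_equation_iff
    unfolding catenary_iff assms(4) dist_xy_param_curve by auto
qed

end
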